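(* There exists a distributed algorithm in the LOCAL model and a function $C$ such that for every planar input graph $G$ and every $\epsilon>0$, the algorithm computes in $C(\epsilon)$ rounds a dominating set of $G$ of size at most $(11+\epsilon)\cdot\gamma(G)$.
   Context: All graphs are finite, undirected and simple. In the LOCAL model the input graph is the communication network: each vertex is a processor with a unique identifier, initially knowing nothing about the graph; in each synchronous round every vertex may send arbitrary messages to its neighbours and perform arbitrary local computation; at the end each vertex decides whether it belongs to the output set. A dominating set of $G$ is a set $D\subseteq V(G)$ such that every vertex is in $D$ or has a neighbour in $D$; $\gamma(G)$ is the minimum size of a dominating set. *)

theory Defs
  imports "HOL-Analysis.Analysis"
begin

text \<open>A graph is a pair (V, E): vertices are natural numbers, which serve as the
unique identifiers of the processors; edges are 2-element subsets of V.\<close>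

type_synonym graph = "nat set \<times> nat set set"

definition verts :: "graph \<Rightarrow> nat set" where "verts G = fst G"
definition edges :: "graph \<Rightarrow> nat set set" where "edges G = snd G"

definition wf_graph :: "graph \<Rightarrow> bool" where
  "wf_graph G \<longleftrightarrow> finite (verts G) \<and>
     (\<forall>e \<in> edges G. e \<subseteq> verts G \<and> card e = 2)"

inductive dist_le :: "graph \<Rightarrow> nat \<Rightarrow> nat \<Rightarrow> nat \<Rightarrow> bool" where
  refl: "v \<in> verts G \<Longrightarrow> dist_le G v v k"
| step: "dist_le G v u k \<Longrightarrow> {u, w} \<in> edges G \<Longrightarrow> dist_le G v w (Suc k)"

text \<open>The information a vertex v has gathered after r rounds of the LOCAL model
(besides its own identifier v): all edges having an endpoint at distance less
than r from v (together with the identifiers of their endpoints).\<close>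
definition local_view :: "graph \<Rightarrow> nat \<Rightarrow> nat \<Rightarrow> nat set set" where
  "local_view G v r = {e \<in> edges G. \<exists>u \<in> e. \<exists>k < r. dist_le G v u k}"

text \<open>A deterministic LOCAL algorithm with parameter eps running in C eps rounds:
the decision of each vertex is a function of its (C eps)-round view.\<close>
definition local_algorithm :: "(real \<Rightarrow> graph \<Rightarrow> nat \<Rightarrow> bool) \<Rightarrow> (real \<Rightarrow> nat) \<Rightarrow> bool" where
  "local_algorithm A C \<longleftrightarrow>
     (\<forall>eps G G' v. wf_graph G \<longrightarrow> wf_graph G' \<longrightarrow> v \<in> verts G \<longrightarrow> v \<in> verts G' \<longrightarrow>
        local_view G v (C eps) = local_view G' v (C eps) \<longrightarrow> A eps G v = A eps G' v)"

definition dominating :: "graph \<Rightarrow> nat set \<Rightarrow> bool" where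
  "dominating G D \<longleftrightarrow> D \<subseteq> verts G \<and>
     (\<forall>v \<in> verts G. v \<in> D \<or> (\<exists>u \<in> D. {u, v} \<in> edges G))"

definition domination_number :: "graph \<Rightarrow> nat" where
  "domination_number G = Min (card ` {D. dominating G D})"

definition planar :: "graph \<Rightarrow> bool" where
  "planar G \<longleftrightarrow> (\<exists>(p :: nat \<Rightarrow> complex) (f :: nat set \<Rightarrow> real \<Rightarrow> complex).
     inj_on p (verts G) \<and>
     (\<forall>e \<in> edges G. arc (f e) \<and> {pathstart (f e), pathfinish (f e)} = p ` e \<and>
        path_image (f e) \<inter> p ` verts G = p ` e) \<and>
     (\<forall>e \<in> edges G. \<forall>e' \<in> edges G. e \<noteq> e' \<longrightarrow>
        path_image (f e) \<inter> path_image (f e') \<subseteq> p ` (e \<inter> e')))"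

end

theory Submission
  imports Defs
begin

text \<open>
  The algorithm does not depend on \<open>eps\<close> and achieves the factor 19/2. Let \<open>D\<close> be an optimal dominating
  set, and let every vertex choose a dominator in \<open>D\<close>. Contracting the stars around \<open>D\<close> and counting
  edges of planar graphs shows that at most \<open>3/2 * card D\<close> vertices outside \<open>D\<close> see at least 8 distinct
  dominators in their neighbourhood.

  First take all vertices whose neighbourhood cannot be dominated by 7 other vertices; those outside
  \<open>D\<close> see 8 dominators. Next take all vertices \<open>v\<close> that share 56 undominated neighbours with some
  \<open>w \<noteq> v\<close>. As there is no \<open>K\<^sub>3\<^sub>,\<^sub>7\<close>, either \<open>w\<close> lies outside \<open>D\<close> and \<open>v\<close> again sees
  8 dominators, or \<open>w \<in> D\<close> is itself taken and has at most 7 such partners. So the vertices of \<open>D\<close> that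
  are taken in these two phases pay for 8 vertices each.

  Now every vertex has at most 393 undominated vertices in its closed neighbourhood, and a primal-dual
  algorithm in the style of Dory, Ghaffari and Ilchi finishes in constantly many rounds: dual weights of
  uncovered vertices grow by the factor 8/7 until some neighbour has load at least 7/8. Since each subgraph
  on \<open>n\<close> vertices has at most \<open>3 * n\<close> edges, this takes at most 8 vertices for each remaining vertex
  of \<open>D\<close>.

  All density bounds come from one Euler inequality for plane graphs, which follows from the Jordan
  curve theorem and Janiszewski's theorem. Stars are contracted implicitly, by not counting
  their edges in the lengths of the face boundaries.
\<close>

section \<open>An Euler inequality for plane graphs\<close>

text \<open>Acyclicity of a finite simple graph, phrased as the existence of a leaf in every
  nonempty set of edges. Inductions can then peel off a leaf, and short cycles are excluded by
  following edges from end to end.\<close>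

definition forest :: "'v set set \<Rightarrow> bool" where
  "forest B \<longleftrightarrow> (\<forall>B'\<subseteq>B. B' \<noteq> {} \<longrightarrow> (\<exists>v. \<exists>!e. e \<in> B' \<and> v \<in> e))"

lemma forest_subset: "forest B \<Longrightarrow> A \<subseteq> B \<Longrightarrow> forest A"
  unfolding forest_def by (meson order_trans)

lemma card_le_2_if_no_three_distinct:
  assumes "\<And>x y z. x \<in> S \<Longrightarrow> y \<in> S \<Longrightarrow> z \<in> S \<Longrightarrow> x = y \<or> y = z \<or> x = z"
  shows "finite S \<and> card S \<le> 2"
proof (rule ccontr)
  assume *: "\<not> (finite S \<and> card S \<le> 2)"
  have "\<exists>T\<subseteq>S. card T = 3"
  proof (cases "finite S")
    case True
    with * have "3 \<le> card S" by simp
    then show ?thesis by (meson obtain_subset_with_card_n)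
  next
    case False
    then show ?thesis using infinite_arbitrarily_large by blast
  qed
  then obtain T where "T \<subseteq> S" "card T = 3" by blast
  then show False
    using assms unfolding card_3_iff by (metis insertCI subsetD)
qed

text \<open>The points are added one at a time: a set meets a single point in a connected set and a
  punctured plane is connected, so Janiszewski's theorem applies.\<close>

lemma connected_Compl_Un_finite:
  fixes S :: "complex set"
  assumes "finite P" "compact S" "connected (- S)"
  shows "connected (- (S \<union> P))"
  using assms
proof (induction P)
  case (insert x P)
  have "connected (- ((S \<union> P) \<union> {x}))"
  proof (rule Janiszewski_connected)
    show "compact (S \<union> P)" using insert by (simp add: compact_Un finite_imp_compact)
    show "connected ((S \<union> P) \<inter> {x})" by (cases "x \<in> S \<union> P") auto
    show "connected (- {x})" by (simp add: connected_punctured_universe)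
  qed (use insert in auto)
  then show ?case by (simp add: Un_commute)
qed auto

lemma connected_subset_singleton: "S \<subseteq> {x} \<Longrightarrow> connected S"
  by (metis connected_empty connected_sing subset_singletonD)

section \<open>Plane drawings, their faces and face boundaries\<close>

locale plane_graph =
  fixes V :: "'v set" and E :: "'v set set" and p :: "'v \<Rightarrow> complex" and f :: "'v set \<Rightarrow> real \<Rightarrow> complex"
  assumes finite_V: "finite V"
    and edge_subset: "e \<in> E \<Longrightarrow> e \<subseteq> V"
    and card_edge: "e \<in> E \<Longrightarrow> card e = 2"
    and inj_p: "inj_on p V"
    and arc_f: "e \<in> E \<Longrightarrow> arc (f e)"
    and ends_f: "e \<in> E \<Longrightarrow> {pathstart (f e), pathfinish (f e)} = p ` e"
    and meet_f: "\<lbrakk>e \<in> E; e' \<in> E; e \<noteq> e'\<rbrakk> \<Longrightarrow> path_image (f e) \<inter> path_image (f e') \<subseteq> p ` (e \<inter> e')"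
begin

definition drawing :: "'v set set \<Rightarrow> complex set" where
  "drawing B = (\<Union>e\<in>B. path_image (f e))"

definition edge_interior :: "'v set \<Rightarrow> complex set" where
  "edge_interior e = path_image (f e) - p ` e"

text \<open>Touching an end of \<open>e\<close> does not count, since a face may touch a vertex
  without bordering all edges at that vertex.\<close>

definition boundary :: "'v set set \<Rightarrow> complex set \<Rightarrow> 'v set set" where
  "boundary B C = {e \<in> B. frontier C \<inter> edge_interior e \<noteq> {}}"

abbreviation faces :: "'v set set \<Rightarrow> complex set set" where
  "faces B \<equiv> components (- drawing B)"

lemma finite_E: "finite E"
proof (rule finite_subset)
  show "E \<subseteq> Pow V" using edge_subset by blast
qed (simp add: finite_V)

lemma finite_edges: "B \<subseteq> E \<Longrightarrow> finite B"
  by (rule finite_subset[OF _ finite_E])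

lemma compact_drawing: "B \<subseteq> E \<Longrightarrow> compact (drawing B)"
  unfolding drawing_def using arc_f finite_edges by (auto intro!: compact_UN compact_arc_image)

lemma closed_drawing: "B \<subseteq> E \<Longrightarrow> closed (drawing B)"
  by (simp add: compact_drawing compact_imp_closed)

lemma drawing_insert: "drawing (insert e B) = path_image (f e) \<union> drawing B"
  by (auto simp: drawing_def)

lemma drawing_mono: "A \<subseteq> B \<Longrightarrow> drawing A \<subseteq> drawing B"
  by (auto simp: drawing_def)

lemma ends_in_path_image: "e \<in> E \<Longrightarrow> p ` e \<subseteq> path_image (f e)"
  using ends_f[of e] by (metis insert_subset empty_subsetI pathfinish_in_path_image pathstart_in_path_image)

lemma arc_meets_drawing:
  assumes "e \<in> E" "B \<subseteq> E" "e \<notin> B"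
  shows "path_image (f e) \<inter> drawing B \<subseteq> p ` (e \<inter> \<Union>B)"
proof
  fix x assume "x \<in> path_image (f e) \<inter> drawing B"
  then obtain e' where "e' \<in> B" "x \<in> path_image (f e)" "x \<in> path_image (f e')"
    by (auto simp: drawing_def)
  then show "x \<in> p ` (e \<inter> \<Union>B)"
    using meet_f[of e e'] assms by blast
qed

text \<open>Remove the edge at a leaf. Its arc does not separate the plane and meets the remaining
  drawing in at most one point, so Janiszewski's theorem lets it be put back.\<close>

lemma connected_Compl_forest:
  assumes "B \<subseteq> E" "forest B"
  shows "connected (- drawing B)"
  using finite_edges[OF assms(1)] assms
proof (induction B rule: finite_psubset_induct)
  case (psubset B)
  show ?case
  proof (cases "B = {}")
    case True
    then show ?thesis by (simp add: drawing_def connected_UNIV)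
  next
    case False
    with psubset.prems obtain v e where e: "e \<in> B" "v \<in> e" "\<And>e'. e' \<in> B \<Longrightarrow> v \<in> e' \<Longrightarrow> e' = e"
      unfolding forest_def by (metis order_refl)
    have eE: "e \<in> E" using e(1) psubset.prems by auto
    obtain w where w: "e = {v, w}"
      using card_edge[OF eE] e(2) by (auto simp: card_2_iff)
    have "path_image (f e) \<inter> drawing (B - {e}) \<subseteq> p ` (e \<inter> \<Union>(B - {e}))"
      by (rule arc_meets_drawing) (use eE psubset.prems in auto)
    also have "\<dots> \<subseteq> {p w}" using e(3) w by blast
    finally have *: "path_image (f e) \<inter> drawing (B - {e}) \<subseteq> {p w}" .
    have "connected (- (path_image (f e) \<union> drawing (B - {e})))"
    proof (rule Janiszewski_connected)
      show "compact (path_image (f e))" using arc_f eE by (simp add: compact_arc_image)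
      show "closed (drawing (B - {e}))" using psubset.prems by (intro closed_drawing) auto
      show "connected (path_image (f e) \<inter> drawing (B - {e}))"
        using * connected_subset_singleton by blast
      show "connected (- path_image (f e))" using arc_f eE by (simp add: connected_arc_complement)
      show "connected (- drawing (B - {e}))"
      proof (rule psubset.IH)
        show "forest (B - {e})" using forest_subset[OF psubset.prems(2)] by blast
      qed (use e(1) psubset.prems(1) in auto)
    qed
    then show ?thesis
      using e(1) by (metis drawing_insert insert_Diff)
  qed
qed

lemma face_disjoint: "C \<in> faces B \<Longrightarrow> C \<inter> drawing B = {}"
  using in_components_subset by fastforce

lemma frontier_face:
  assumes "B \<subseteq> E" "C \<in> faces B"
  shows "frontier C \<subseteq> drawing B"
  using assms closed_drawing frontier_of_components_closed_complement by blast

text \<open>The frontier of \<open>C\<close> lies in a set \<open>Y\<close> with connected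
  complement. This complement meets \<open>C\<close> and avoids its frontier, so it lies in
  \<open>C\<close>; it also contains every other face.\<close>

lemma faces_singleton_if_forest_boundary:
  assumes B: "B \<subseteq> E" and C: "C \<in> faces B" and fo: "forest (boundary B C)"
  shows "faces B = {C}"
proof -
  \<comment> \<open>The vertex points are included because the frontier may reach an edge outside
    \<open>boundary B C\<close> at one of its ends.\<close>
  define Y where "Y = drawing (boundary B C) \<union> p ` (\<Union>B)"
  have bB: "boundary B C \<subseteq> B" by (auto simp: boundary_def)
  have "\<Union>B \<subseteq> V" using B edge_subset by blast
  then have "finite (\<Union>B)" by (rule finite_subset) (rule finite_V)
  moreover have bE: "boundary B C \<subseteq> E" using bB B by blast
  ultimately have cY: "connected (- Y)"
    unfolding Y_def
    using connected_Compl_Un_finite[OF finite_imageI compact_drawing connected_Compl_forest[OF _ fo]] by blast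
  have YX: "Y \<subseteq> drawing B"
    using bB ends_in_path_image B unfolding Y_def drawing_def by fast
  have fr: "frontier C \<subseteq> Y"
  proof
    fix x assume x: "x \<in> frontier C"
    then obtain e where e: "e \<in> B" "x \<in> path_image (f e)"
      using frontier_face[OF B C] by (auto simp: drawing_def)
    show "x \<in> Y"
    proof (cases "x \<in> p ` e")
      case False
      then have "e \<in> boundary B C" using x e by (auto simp: boundary_def edge_interior_def)
      then show ?thesis using e by (auto simp: Y_def drawing_def)
    qed (use e in \<open>auto simp: Y_def\<close>)
  qed
  have CY: "C \<subseteq> - Y" "C \<noteq> {}" using face_disjoint[OF C] YX C in_components_nonempty by blast+
  have "- Y \<subseteq> C"
    using connected_Int_frontier[OF cY, of C] CY fr by blast
  then have "D \<subseteq> C" if "D \<in> faces B" for D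
    using YX in_components_subset[OF that] by blast
  then have "D = C" if "D \<in> faces B" for D
    using that C components_nonoverlap[OF that C] in_components_nonempty[OF that] by blast
  then show ?thesis using C by blast
qed

section \<open>Faces on the two sides of an edge\<close>

lemma connected_edge_interior: "e \<in> E \<Longrightarrow> connected (edge_interior e)"
  unfolding edge_interior_def using ends_f[of e] arc_f[of e]
  by (metis arc_imp_simple_path connected_simple_path_endless)

lemma edge_interior_nonempty: "e \<in> E \<Longrightarrow> edge_interior e \<noteq> {}"
  unfolding edge_interior_def using ends_f[of e] arc_f[of e]
  by (metis arc_imp_simple_path nonempty_simple_path_endless)

lemma edge_interior_disjoint_drawing:
  assumes "e \<in> E" "B \<subseteq> E" "e \<notin> B"
  shows "edge_interior e \<inter> drawing B = {}"
  using arc_meets_drawing[OF assms] by (auto simp: edge_interior_def)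

text \<open>A path in the drawing between the ends of \<open>e\<close> contains an arc
  \<open>\<beta>\<close>, which closes the arc of \<open>e\<close> to a Jordan curve. The new arc
  meets the drawing at most at its own ends, and these lie on \<open>\<beta>\<close>.\<close>

lemma arc_between_ends:
  assumes B: "B \<subseteq> E" and e: "e \<in> E" "e \<notin> B" "e = {a, b}" and c: "path_component (drawing B) (p a) (p b)"
  obtains c \<beta> where "simple_path c" "pathfinish c = pathstart c" "path_image c = path_image (f e) \<union> path_image \<beta>"
     "arc \<beta>" "path_image \<beta> \<subseteq> drawing B" "path_image (f e) \<inter> drawing B \<subseteq> path_image \<beta>"
proof -
  have ab: "a \<noteq> b" using card_edge[OF e(1)] e(3) by auto
  have pab: "p a \<noteq> p b"
    using ab inj_p edge_subset[OF e(1)] e(3) by (auto simp: inj_on_def)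
  have en: "{pathstart (f e), pathfinish (f e)} = {p a, p b}" using ends_f[OF e(1)] e(3) by auto
  have c': "path_component (drawing B) (pathfinish (f e)) (pathstart (f e))"
    using en pab c path_component_sym by (metis doubleton_eq_iff)
  then obtain g where g: "path g" "path_image g \<subseteq> drawing B" "pathstart g = pathfinish (f e)" "pathfinish g = pathstart (f e)"
    by (auto simp: path_component_def)
  have ne: "pathfinish (f e) \<noteq> pathstart (f e)" using en pab by (metis doubleton_eq_iff)
  obtain \<beta> where \<beta>: "arc \<beta>" "path_image \<beta> \<subseteq> path_image g" "pathstart \<beta> = pathfinish (f e)" "pathfinish \<beta> = pathstart (f e)"
    using path_contains_arc[OF g(1,3,4) ne] by blast
  have m: "path_image (f e) \<inter> drawing B \<subseteq> {pathstart (f e), pathfinish (f e)}"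
    using arc_meets_drawing[OF e(1) B e(2)] ends_f[OF e(1)] by auto
  show thesis
  proof
    show "simple_path (f e +++ \<beta>)"
      by (rule simple_path_join_loop) (use \<beta> arc_f[OF e(1)] m g in auto)
    show "path_image (f e +++ \<beta>) = path_image (f e) \<union> path_image \<beta>"
      using \<beta> by (simp add: path_image_join)
    show "path_image (f e) \<inter> drawing B \<subseteq> path_image \<beta>"
      using m \<beta> by (metis pathfinish_in_path_image pathstart_in_path_image empty_subsetI insert_subset order_trans)
  qed (use \<beta> g in auto)
qed

text \<open>Hence all faces that border \<open>e\<close> merge into one when \<open>e\<close> is
  erased.\<close>

lemma frontier_face_meets_connected:
  assumes B: "B \<subseteq> E" and e: "e \<in> E" "e \<notin> B" and C: "C \<in> faces (insert e B)" and m: "frontier C \<inter> edge_interior e \<noteq> {}"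
  shows "connected (C \<union> edge_interior e)" "C \<union> edge_interior e \<subseteq> - drawing B"
proof -
  obtain z where z: "z \<in> frontier C" "z \<in> edge_interior e" using m by auto
  have "connected (insert z C)"
    by (rule connected_intermediate_closure[of C])
      (use in_components_connected[OF C] z in \<open>auto simp: frontier_def closure_subset[THEN subsetD]\<close>)
  then have "connected (insert z C \<union> edge_interior e)"
    by (rule connected_Un) (use z connected_edge_interior e in auto)
  then show "connected (C \<union> edge_interior e)" using z by (simp add: insert_absorb)
  show "C \<union> edge_interior e \<subseteq> - drawing B"
    using face_disjoint[OF C] edge_interior_disjoint_drawing[OF e(1) B e(2)] by (auto simp: drawing_insert)
qed

text \<open>
  If \<open>e\<close> closes a cycle \<open>J\<close> in the drawing, two of three faces at \<open>e\<close> lie on the same side of \<open>J\<close>, and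
  Janiszewski's theorem applied to \<open>J\<close> and the drawing without \<open>e\<close>, which meet in an arc, shows that these
  two faces coincide. If \<open>e\<close> is a bridge, its two sides can be attached to \<open>e\<close> one after the other, each
  meeting the rest in at most one point.
\<close>

lemma faces_at_edge:
  assumes B: "B \<subseteq> E" and e: "e \<in> E" "e \<notin> B"
  shows "finite {C \<in> faces (insert e B). frontier C \<inter> edge_interior e \<noteq> {}} \<and>
         card {C \<in> faces (insert e B). frontier C \<inter> edge_interior e \<noteq> {}} \<le> 2"
    (is "finite ?F \<and> card ?F \<le> 2")
proof (rule card_le_2_if_no_three_distinct)
  fix C1 C2 C3 assume C123: "C1 \<in> ?F" "C2 \<in> ?F" "C3 \<in> ?F"
  obtain a b where ab: "e = {a, b}" "a \<noteq> b"
    using card_edge[OF e(1)] by (auto simp: card_2_iff)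
  define K where "K = drawing B"
  have K: "compact K" "closed K" using B by (simp_all add: K_def compact_drawing closed_drawing)
  have conn: "connected_component (- K) x y"
    if "C \<in> ?F" "D \<in> ?F" "x \<in> C" "y \<in> D" for C D x y
  proof -
    have "connected ((C \<union> edge_interior e) \<union> (D \<union> edge_interior e))"
      by (rule connected_Un)
        (use that frontier_face_meets_connected(1)[OF B e] edge_interior_nonempty[OF e(1)] in auto)
    moreover have "(C \<union> edge_interior e) \<union> (D \<union> edge_interior e) \<subseteq> - K"
      using that frontier_face_meets_connected(2)[OF B e, of C] frontier_face_meets_connected(2)[OF B e, of D]
      by (auto simp: K_def)
    ultimately show ?thesis
      unfolding connected_component_def using that by blast
  qed
  have same: "C = D" if "C \<in> ?F" "D \<in> ?F" "x \<in> C" "y \<in> D" "connected_component (- (path_image (f e) \<union> K)) x y" for C D x y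
    using that joinable_components_eq[of _ "- drawing (insert e B)" C D]
    unfolding connected_component_def drawing_insert K_def by blast
  obtain x1 x2 x3 where x: "x1 \<in> C1" "x2 \<in> C2" "x3 \<in> C3"
    using C123 in_components_nonempty by (metis (no_types, lifting) mem_Collect_eq ex_in_conv)
  show "C1 = C2 \<or> C2 = C3 \<or> C1 = C3"
  proof (cases "path_component K (p a) (p b)")
    case True
    then obtain c \<beta> where c: "simple_path c" "pathfinish c = pathstart c" "path_image c = path_image (f e) \<union> path_image \<beta>"
     "arc \<beta>" "path_image \<beta> \<subseteq> K" "path_image (f e) \<inter> K \<subseteq> path_image \<beta>"
      using arc_between_ends[OF B e ab(1)] unfolding K_def by metis
    define J where "J = path_image c"
    have J: "connected (inside J)" "connected (outside J)" "inside J \<union> outside J = - J"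
      using Jordan_inside_outside[OF c(1,2)] by (auto simp: J_def)
    have KJ: "K \<inter> J = path_image \<beta>" "K \<union> J = path_image (f e) \<union> K" using c by (auto simp: J_def)
    have xJ: "x \<in> - J" if "C \<in> ?F" "x \<in> C" for x C
      using face_disjoint[of C "insert e B"] that KJ(2) by (auto simp: drawing_insert K_def)
    have "C = D" if CD: "C \<in> ?F" "D \<in> ?F" "x \<in> C" "y \<in> D" and s: "x \<in> inside J \<longleftrightarrow> y \<in> inside J" for C D x y
    proof -
      have "connected_component (- J) x y"
      proof (cases "x \<in> inside J")
        case True
        then show ?thesis unfolding connected_component_def using J s by blast
      next
        case False
        then have "x \<in> outside J" "y \<in> outside J" using s J(3) xJ CD by blast+
        then show ?thesis unfolding connected_component_def using J by blast
      qed
      moreover have "closed J" using c(1) by (simp add: J_def closed_simple_path_image)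
      moreover have "connected (K \<inter> J)" using KJ(1) c(4) by (simp add: connected_arc_image)
      ultimately have "connected_component (- (K \<union> J)) x y"
        using Janiszewski[OF K(1)] conn[OF CD] by blast
      then show ?thesis using same[OF CD] KJ by simp
    qed
    from this[OF C123(1,2) x(1,2)] this[OF C123(2,3) x(2,3)] this[OF C123(1,3) x(1,3)]
    show ?thesis by blast
  next
    case False
    \<comment> \<open>The vertices on the side of \<open>a\<close>. The vertex \<open>a\<close> is
      listed separately because \<open>p a\<close> need not lie on \<open>K\<close>, in which case
      it is in no path component of \<open>K\<close>.\<close>
    define A where "A = {v. v = a \<or> path_component K (p a) (p v)}"
    define E1 where "E1 = {e' \<in> B. e' \<inter> A \<noteq> {}}"
    define E2 where "E2 = B - E1"
    have bA: "b \<notin> A" using False ab by (auto simp: A_def)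
    have E1A: "e' \<subseteq> A" if e': "e' \<in> E1" for e'
    proof
      fix w assume w: "w \<in> e'"
      obtain v where v: "v \<in> e'" "v \<in> A" using e' by (auto simp: E1_def)
      have e'B: "e' \<in> B" "e' \<in> E" using e' B by (auto simp: E1_def)
      have "p v \<in> path_image (f e')" "p w \<in> path_image (f e')"
        using ends_in_path_image[OF e'B(2)] v w by auto
      moreover have "path_connected (path_image (f e'))"
        using arc_f[OF e'B(2)] by (simp add: arc_imp_path path_connected_path_image)
      moreover have "path_image (f e') \<subseteq> K" using e'B by (auto simp: K_def drawing_def)
      ultimately have "path_component K (p v) (p w)"
        by (meson path_component_of_subset path_connected_component)
      then show "w \<in> A" using v path_component_trans by (auto simp: A_def)
    qed
    have B12: "B = E1 \<union> E2" "E1 \<subseteq> E" "E2 \<subseteq> E" "e \<notin> E1" "e \<notin> E2"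
      using B e by (auto simp: E1_def E2_def)
    define K1 where "K1 = drawing E1"
    define K2 where "K2 = drawing E2"
    have K12: "K = K1 \<union> K2" using B12 by (auto simp: K_def K1_def K2_def drawing_def)
    have i1: "path_image (f e) \<inter> K1 \<subseteq> {p a}"
      using arc_meets_drawing[OF e(1) B12(2,4)] E1A bA ab by (auto simp: K1_def)
    have i2: "path_image (f e) \<inter> K2 \<subseteq> {p b}"
      using arc_meets_drawing[OF e(1) B12(3,5)] ab by (auto simp: K2_def E2_def E1_def A_def)
    have i3: "K1 \<inter> K2 = {}"
    proof (rule ccontr)
      assume "K1 \<inter> K2 \<noteq> {}"
      then obtain e1 e2 z where e12: "e1 \<in> E1" "e2 \<in> E2" "z \<in> path_image (f e1)" "z \<in> path_image (f e2)"
        by (auto simp: K1_def K2_def drawing_def)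
      then have "e1 \<noteq> e2" by (auto simp: E2_def)
      then have "z \<in> p ` (e1 \<inter> e2)" using meet_f[of e1 e2] e12 B12 by blast
      then show False using E1A[OF e12(1)] e12(2) by (auto simp: E2_def E1_def)
    qed
    have "connected_component (- K) x1 x2" using conn C123 x by blast
    then have k: "connected_component (- K1) x1 x2" "connected_component (- K2) x1 x2"
      using K12 connected_component_of_subset by (metis Compl_anti_mono Un_upper1 Un_upper2)+
    have xi: "x1 \<notin> path_image (f e)" "x2 \<notin> path_image (f e)"
      using face_disjoint[of C1 "insert e B"] face_disjoint[of C2 "insert e B"] C123 x by (auto simp: drawing_insert)
    have a1: "connected_component (- (K1 \<union> path_image (f e))) x1 x2"
    proof (rule Janiszewski)
      show "compact K1" using B12 by (simp add: K1_def compact_drawing)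
      show "closed (path_image (f e))" using arc_f[OF e(1)] by (simp add: closed_arc_image)
      show "connected (K1 \<inter> path_image (f e))" using i1 connected_subset_singleton by (metis Int_commute)
      have "connected (- path_image (f e))" using arc_f e by (simp add: connected_arc_complement)
      then show "connected_component (- path_image (f e)) x1 x2"
        using xi by (simp add: connected_iff_connected_component)
    qed fact
    have "connected_component (- ((K1 \<union> path_image (f e)) \<union> K2)) x1 x2"
    proof (rule Janiszewski)
      show "compact (K1 \<union> path_image (f e))"
        using B12 arc_f[OF e(1)] by (simp add: K1_def compact_drawing compact_Un compact_arc_image)
      show "closed K2" using B12 by (simp add: K2_def closed_drawing)
      have "(K1 \<union> path_image (f e)) \<inter> K2 \<subseteq> {p b}" using i2 i3 by blast
      then show "connected ((K1 \<union> path_image (f e)) \<inter> K2)" using connected_subset_singleton by blast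
    qed fact+
    then have "connected_component (- (path_image (f e) \<union> K)) x1 x2"
      by (simp add: K12 Un_ac)
    then show ?thesis using same C123 x by blast
  qed
qed

section \<open>Counting faces and edges\<close>

lemma boundary_le_2:
  assumes "B \<subseteq> E" "e \<in> B"
  shows "finite {C \<in> faces B. e \<in> boundary B C} \<and> card {C \<in> faces B. e \<in> boundary B C} \<le> 2"
  using faces_at_edge[of "B - {e}" e] assms by (auto simp: boundary_def insert_absorb)

text \<open>A face after the insertion of \<open>e\<close> whose frontier avoids the interior of
  \<open>e\<close> is an old face minus the ends of \<open>e\<close>; the latter is connected
  because old faces are open. The other faces are bounded by \<open>faces_at_edge\<close>.\<close>

lemma finite_faces:
  assumes "B \<subseteq> E" shows "finite (faces B)"
  using finite_edges[OF assms] assms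
proof (induction B)
  case empty
  show ?case by (simp add: drawing_def components_def)
next
  case (insert e B)
  let ?F = "{C \<in> faces (insert e B). frontier C \<inter> edge_interior e \<noteq> {}}"
  have B: "B \<subseteq> E" "e \<in> E" using insert by auto
  have "faces (insert e B) \<subseteq> (\<lambda>D. D - p ` e) ` faces B \<union> ?F"
  proof
    fix C assume C: "C \<in> faces (insert e B)"
    show "C \<in> (\<lambda>D. D - p ` e) ` faces B \<union> ?F"
    proof (cases "frontier C \<inter> edge_interior e = {}")
      case True
      have Cd: "C \<inter> (path_image (f e) \<union> drawing B) = {}" using face_disjoint[OF C] by (simp add: drawing_insert)
      have cC: "connected C" "C \<noteq> {}" using C in_components_connected in_components_nonempty by auto
      have "- drawing B \<noteq> {}" "C \<subseteq> - drawing B" using Cd cC by blast+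
      then obtain D where D: "D \<in> faces B" "C \<subseteq> D"
        using exists_component_superset[of C "- drawing B"] cC by blast
      have "open D" using D(1) B closed_drawing open_components by blast
      moreover have "finite (p ` e)" using card_edge[OF B(2)] by (metis card.infinite finite_imageI zero_neq_numeral)
      ultimately have cD: "connected (D - p ` e)"
        using D(1) in_components_connected by (metis connected_open_delete_finite DIM_complex order_refl countable_finite)
      have CD: "C \<subseteq> D - p ` e" using D Cd ends_in_path_image[OF B(2)] by blast
      have "(D - p ` e) \<inter> frontier C = {}"
        using frontier_face[OF insert.prems C] True in_components_subset[OF D(1)]
        by (auto simp: drawing_insert edge_interior_def)
      then have "D - p ` e \<subseteq> C"
        using connected_Int_frontier[OF cD, of C] CD cC by blast
      then show ?thesis using CD D by blast
    qed (use C in auto)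
  qed
  moreover have "finite ?F" using faces_at_edge[OF B insert.hyps(2)] by blast
  ultimately show ?case
    using insert.IH[OF B(1)] by (meson finite_UnI finite_imageI finite_subset)
qed

text \<open>The interior of \<open>e\<close> lies in one old face \<open>g\<close>. A point of it is
  on the frontier of both sides of the Jordan curve through \<open>e\<close>, so the open set
  \<open>g\<close> contains points of both sides, and these lie in different new faces. All other
  old faces survive.\<close>

lemma card_faces_insert:
  assumes B: "B \<subseteq> E" and e: "e \<in> E" "e \<notin> B" "e = {a, b}" and con: "path_component (drawing B) (p a) (p b)"
  shows "card (faces B) + 1 \<le> card (faces (insert e B))"
proof -
  obtain c \<beta> where c: "simple_path c" "pathfinish c = pathstart c" "path_image c = path_image (f e) \<union> path_image \<beta>"
     "path_image \<beta> \<subseteq> drawing B"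
      using arc_between_ends[OF B e con] by metis
  define J where "J = path_image c"
  have J: "inside J \<inter> outside J = {}" "frontier (inside J) = J" "frontier (outside J) = J" "inside J \<union> outside J = - J"
    using Jordan_inside_outside[OF c(1,2)] by (auto simp: J_def)
  have JB: "J \<subseteq> drawing (insert e B)" using c by (auto simp: J_def drawing_insert)
  have ie: "edge_interior e \<subseteq> - drawing B" "edge_interior e \<noteq> {}" "connected (edge_interior e)"
    using edge_interior_disjoint_drawing[OF e(1) B e(2)] edge_interior_nonempty[OF e(1)] connected_edge_interior[OF e(1)] by auto
  then have "- drawing B \<noteq> {}" by blast
  then obtain g where g: "g \<in> faces B" "edge_interior e \<subseteq> g"
    using exists_component_superset[of "edge_interior e" "- drawing B"] ie by blast
  have og: "open g" using g(1) B closed_drawing open_components by blast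
  obtain z where z: "z \<in> edge_interior e" using ie by blast
  have zJ: "z \<in> J" using z by (auto simp: J_def c edge_interior_def)
  have "z \<in> closure (inside J)" "z \<in> closure (outside J)"
    using zJ J(2,3) unfolding frontier_def by blast+
  then have "g \<inter> inside J \<noteq> {}" "g \<inter> outside J \<noteq> {}"
    using og g(2) z open_Int_closure_eq_empty by blast+
  then obtain y1 y2 where y: "y1 \<in> g" "y1 \<in> inside J" "y2 \<in> g" "y2 \<in> outside J" by blast
  have pB: "p ` e \<subseteq> drawing B" using con path_component_mem e(3) by fastforce
  have gB: "g \<inter> drawing B = {}" using face_disjoint[OF g(1)] .
  have yn: "y \<in> - drawing (insert e B)" if "y \<in> g" "y \<notin> J" for y
    using that gB by (auto simp: drawing_insert J_def c)
  define C where "C y = connected_component_set (- drawing (insert e B)) y" for y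
  have y': "y1 \<in> - drawing (insert e B)" "y2 \<in> - drawing (insert e B)"
    using y J(4) yn by blast+
  have CF: "C y1 \<in> faces (insert e B)" "C y2 \<in> faces (insert e B)" "y1 \<in> C y1" "y2 \<in> C y2"
    using y' by (auto simp: C_def components_def)
  have Cg: "C y \<subseteq> g" if "C y \<in> faces (insert e B)" "y \<in> C y" "y \<in> g" for y
    using components_maximal[OF g(1), of "C y"] that in_components_connected in_components_subset[OF that(1)]
    by (auto simp: drawing_insert)
  have C12: "C y1 \<noteq> C y2"
  proof
    assume eq: "C y1 = C y2"
    have "C y1 \<inter> frontier (inside J) \<noteq> {}"
      using connected_Int_frontier[of "C y1" "inside J"] in_components_connected[OF CF(1)] CF y eq J(1) by blast
    then show False using J(2) JB face_disjoint[OF CF(1)] by blast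
  qed
  have notold: "C y \<notin> faces B - {g}" if "C y \<in> faces (insert e B)" "y \<in> C y" "y \<in> g" for y
    using components_nonoverlap[of "C y" "- drawing B" g] g(1) that by blast
  have old: "D \<in> faces (insert e B)" if D: "D \<in> faces B" "D \<noteq> g" for D
  proof (rule components_intermediate_subset[OF D(1)])
    have "D \<inter> g = {}" using components_nonoverlap[of D "- drawing B" g] D g by blast
    then have "D \<inter> path_image (f e) = {}"
      using g(2) pB face_disjoint[OF D(1)] by (auto simp: edge_interior_def)
    then show "D \<subseteq> - drawing (insert e B)" using face_disjoint[OF D(1)] by (auto simp: drawing_insert)
    show "- drawing (insert e B) \<subseteq> - drawing B" by (auto simp: drawing_insert)
  qed
  have fin: "finite (faces B)" "finite (faces (insert e B))" using finite_faces B e by auto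
  have "card (insert (C y1) (insert (C y2) (faces B - {g}))) = card (faces B) + 1"
    using fin notold CF y C12 g(1) card_Suc_Diff1[OF fin(1) g(1)] by simp
  moreover have "insert (C y1) (insert (C y2) (faces B - {g})) \<subseteq> faces (insert e B)"
    using CF old by auto
  ultimately show ?thesis using card_mono[OF fin(2)] by metis
qed

text \<open>Kruskal's procedure: an edge inside a class of \<open>r\<close> is skipped, any other
  edge enters \<open>T\<close> and merges two classes. Acyclicity of \<open>T\<close> appears only
  as the count of edges against classes. The case \<open>r v = v\<close> covers vertices that are
  not on the drawing.\<close>

lemma spanning_forest:
  assumes "B \<subseteq> E"
  shows "\<exists>T\<subseteq>B. \<exists>r. card T + card (r ` V) \<le> card V \<and>
    (\<forall>v. r v = v \<or> path_component (drawing T) (p v) (p (r v))) \<and> (\<forall>e\<in>B. \<forall>u\<in>e. \<forall>v\<in>e. r u = r v)"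
  using finite_edges[OF assms] assms
proof (induction B)
  case empty
  have "card {} + card (id ` V) \<le> card V" by simp
  then show ?case by (metis empty_iff id_apply order_refl)
next
  case (insert e B)
  then obtain T r where T: "T \<subseteq> B" "card T + card (r ` V) \<le> card V"
     "\<And>v. r v = v \<or> path_component (drawing T) (p v) (p (r v))"
     "\<And>e u v. e \<in> B \<Longrightarrow> u \<in> e \<Longrightarrow> v \<in> e \<Longrightarrow> r u = r v" by (metis insert_subset)
  have e: "e \<in> E" using insert by auto
  obtain a b where ab: "e = {a, b}" "a \<noteq> b" "a \<in> V" "b \<in> V"
    using card_edge[OF e] edge_subset[OF e] by (auto simp: card_2_iff)
  show ?case
  proof (cases "r a = r b")
    case True
    have "r u = r v" if "e' \<in> insert e B" "u \<in> e'" "v \<in> e'" for e' u v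
      using that T(4)[of e' u v] True ab(1) by auto
    moreover have "T \<subseteq> insert e B" using T(1) by blast
    ultimately show ?thesis using T(2,3) by metis
  next
    case False
    let ?T = "insert e T"
    define r' where "r' v = (if r v = r b then r a else r v)" for v
    have finT: "finite T" "e \<notin> T" using T insert finite_subset by auto
    have "r' ` V \<subseteq> r ` V - {r b}" using False ab by (auto simp: r'_def)
    then have "card (r' ` V) \<le> card (r ` V) - 1"
      using finite_V ab by (metis card_Diff_singleton card_mono finite_Diff finite_imageI image_eqI)
    moreover have "card (r ` V) > 0" using finite_V ab by (auto simp: card_gt_0_iff)
    ultimately have c: "card ?T + card (r' ` V) \<le> card V" using T(2) finT by simp
    define con where "con u v \<longleftrightarrow> u = v \<or> path_component (drawing ?T) (p u) (p v)" for u v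
    have ct: "con u v \<Longrightarrow> con v w \<Longrightarrow> con u w" for u v w
      unfolding con_def using path_component_trans by metis
    have cs: "con u v \<Longrightarrow> con v u" for u v
      unfolding con_def using path_component_sym by metis
    have cr: "con v (r v)" for v
      unfolding con_def using T(3)[of v] path_component_of_subset[OF drawing_mono, of T ?T] by auto
    have "path_connected (path_image (f e))" using arc_f[OF e] by (simp add: arc_imp_path path_connected_path_image)
    then have "path_component (path_image (f e)) (p b) (p a)"
      using ends_in_path_image[OF e] ab path_connected_component by auto
    then have "con b a" unfolding con_def using path_component_of_subset by (metis drawing_insert Un_upper1)
    then have rba: "con (r b) (r a)" using ct[OF cs[OF cr] ct[OF _ cr]] by blast
    have "con v (r' v)" for v
    proof (cases "r v = r b")
      case True
      then show ?thesis using ct[OF cr[of v]] rba by (simp add: r'_def)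
    qed (simp add: r'_def cr)
    moreover have "r' u = r' v" if "e' \<in> insert e B" "u \<in> e'" "v \<in> e'" for e' u v
      using that T(4)[of e' u v] ab by (auto simp: r'_def)
    moreover have "?T \<subseteq> insert e B" using T(1) by blast
    ultimately show ?thesis
      using c unfolding con_def by metis
  qed
qed

text \<open>One half of Euler's formula: the drawing of \<open>T\<close> has at least one face, and
  each edge outside \<open>T\<close> closes a cycle and so adds a face.\<close>

lemma card_faces_lower: "card E + 1 \<le> card V + card (faces E)"
proof -
  obtain T r where T: "T \<subseteq> E" "card T + card (r ` V) \<le> card V"
     "\<And>v. r v = v \<or> path_component (drawing T) (p v) (p (r v))"
     "\<And>e u v. e \<in> E \<Longrightarrow> u \<in> e \<Longrightarrow> v \<in> e \<Longrightarrow> r u = r v"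
    using spanning_forest[OF order_refl] by metis
  have grow: "card (faces (T \<union> D)) \<ge> 1 + card D" if "finite D" "D \<subseteq> E - T" for D
    using that
  proof (induction D)
    case empty
    have "drawing T \<noteq> UNIV" using compact_drawing[OF T(1)] not_compact_UNIV by metis
    then have "faces T \<noteq> {}" by auto
    then show ?case using finite_faces[OF T(1)] by (simp add: Suc_le_eq card_gt_0_iff)
  next
    case (insert e D)
    have e: "e \<in> E" "e \<notin> T \<union> D" "T \<union> D \<subseteq> E" using insert T by auto
    obtain a b where ab: "e = {a, b}" "a \<noteq> b"
      using card_edge[OF e(1)] by (auto simp: card_2_iff)
    have "r a = r b" using T(4) ab e by blast
    then have "path_component (drawing T) (p a) (p b)"
      using T(3)[of a] T(3)[of b] ab path_component_sym path_component_trans by metis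
    then have "path_component (drawing (T \<union> D)) (p a) (p b)"
      using path_component_of_subset drawing_mono by (metis Un_upper1)
    then have "card (faces (T \<union> D)) + 1 \<le> card (faces (insert e (T \<union> D)))"
      using card_faces_insert e ab by blast
    then show ?case using insert by simp
  qed
  have "T \<union> (E - T) = E" using T(1) by blast
  then have "card (faces E) \<ge> 1 + card (E - T)" using grow[of "E - T"] finite_E by simp
  moreover have "card E = card T + card (E - T)"
    using T finite_E by (metis card_Diff_subset card_mono finite_subset le_add_diff_inverse)
  ultimately show ?thesis using T(2) by linarith
qed

text \<open>
  The edges outside \<open>R\<close> do not contribute to the lengths of face boundaries. This is what contracting
  them would achieve.
\<close>

theorem weighted_Euler_inequality:
  assumes R: "R \<subseteq> E" and g: "\<And>B. B \<subseteq> E \<Longrightarrow> card (B \<inter> R) < g \<Longrightarrow> forest B"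
  shows "g * card E \<le> 2 * card R + g * card V"
proof (cases "card (faces E) \<le> 1")
  case True
  then have "card E \<le> card V" using card_faces_lower by linarith
  then show ?thesis by (simp add: trans_le_add2)
next
  case False
  have fin: "finite (faces E)" "finite R" using finite_faces R finite_edges by auto
  \<comment> \<open>With two or more faces no boundary is a forest, so each contains
    \<open>g\<close> edges of \<open>R\<close>. Counting incidences of faces with \<open>R\<close>
    from both sides bounds the number of faces.\<close>
  have "g \<le> card (boundary E C \<inter> R)" if "C \<in> faces E" for C
  proof (rule ccontr)
    assume "\<not> ?thesis"
    then have "forest (boundary E C)" by (intro g) (auto simp: boundary_def)
    then have "faces E = {C}" using faces_singleton_if_forest_boundary that by blast
    then show False using False by simp
  qed
  then have "(\<Sum>C\<in>faces E. g) \<le> (\<Sum>C\<in>faces E. card (boundary E C \<inter> R))"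
    by (rule sum_mono)
  also have "\<dots> = (\<Sum>C\<in>faces E. \<Sum>e\<in>R. if e \<in> boundary E C then 1 else 0)"
    using fin by (simp add: sum.If_cases Int_commute)
  also have "\<dots> = (\<Sum>e\<in>R. \<Sum>C\<in>faces E. if e \<in> boundary E C then 1 else 0)"
    by (rule sum.swap)
  also have "\<dots> = (\<Sum>e\<in>R. card {C \<in> faces E. e \<in> boundary E C})"
    using fin by (simp add: sum.If_cases Int_def)
  also have "\<dots> \<le> (\<Sum>e\<in>R. 2)"
    using boundary_le_2[of E] R by (intro sum_mono) auto
  finally have "g * card (faces E) \<le> 2 * card R" by (simp add: mult.commute)
  moreover have "g * card E \<le> g * (card V + card (faces E))"
    using card_faces_lower by (intro mult_le_mono2) simp
  ultimately show ?thesis by (simp add: distrib_left)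
qed

end

section \<open>Density of planar graphs\<close>

lemma plane_graph_subgraph:
  assumes "plane_graph V E p f" "E' \<subseteq> E" "V' \<subseteq> V" "\<And>e. e \<in> E' \<Longrightarrow> e \<subseteq> V'"
  shows "plane_graph V' E' p f"
proof -
  interpret plane_graph V E p f by fact
  show ?thesis
  proof
    show "finite V'" using finite_V assms(3) by (rule rev_finite_subset)
    show "inj_on p V'" using inj_p assms(3) by (rule inj_on_subset)
    fix e assume "e \<in> E'"
    then have e: "e \<in> E" "e \<subseteq> V'" using assms(2,4) by auto
    then show "e \<subseteq> V'" "card e = 2" "arc (f e)" "{pathstart (f e), pathfinish (f e)} = p ` e"
      by (simp_all only: card_edge arc_f ends_f)
    fix e' assume "e' \<in> E'" "e \<noteq> e'"
    then show "path_image (f e) \<inter> path_image (f e') \<subseteq> p ` (e \<inter> e')"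
      using meet_f[OF e(1), of e'] assms(2) by blast
  qed
qed

lemma planar_imp_plane_graph:
  assumes "wf_graph G" "planar G"
  obtains p f where "plane_graph (verts G) (edges G) p f"
proof -
  obtain p :: "nat \<Rightarrow> complex" and f where pf: "inj_on p (verts G)"
    "\<forall>e\<in>edges G. arc (f e) \<and> {pathstart (f e), pathfinish (f e)} = p ` e \<and>
        path_image (f e) \<inter> p ` verts G = p ` e"
    "\<forall>e\<in>edges G. \<forall>e'\<in>edges G. e \<noteq> e' \<longrightarrow>
        path_image (f e) \<inter> path_image (f e') \<subseteq> p ` (e \<inter> e')"
    using assms(2) unfolding planar_def by blast
  have "plane_graph (verts G) (edges G) p f"
  proof
    show "finite (verts G)" using assms(1) by (simp add: wf_graph_def)
    show "inj_on p (verts G)" by (rule pf(1))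
    fix e assume e: "e \<in> edges G"
    show "e \<subseteq> verts G" "card e = 2" using e assms(1) unfolding wf_graph_def by blast+
    show "arc (f e)" "{pathstart (f e), pathfinish (f e)} = p ` e" using pf(2) e by blast+
    fix e' assume "e' \<in> edges G" "e \<noteq> e'"
    then show "path_image (f e) \<inter> path_image (f e') \<subseteq> p ` (e \<inter> e')" using pf(3) e by blast
  qed
  then show thesis by (rule that)
qed

lemma planar_weighted_Euler:
  assumes "wf_graph G" "planar G" "E \<subseteq> edges G" "V \<subseteq> verts G" "\<And>e. e \<in> E \<Longrightarrow> e \<subseteq> V"
    and "R \<subseteq> E" "\<And>B. B \<subseteq> E \<Longrightarrow> card (B \<inter> R) < g \<Longrightarrow> forest B"
  shows "g * card E \<le> 2 * card R + g * card V"
proof -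
  obtain p f where pf: "plane_graph (verts G) (edges G) p f"
    using planar_imp_plane_graph assms(1,2) by blast
  interpret plane_graph V E p f
    by (rule plane_graph_subgraph[OF pf assms(3-5)])
  show ?thesis by (rule weighted_Euler_inequality[OF assms(6,7)])
qed

section \<open>Edge sets too small to contain a cycle\<close>

lemma forestI:
  assumes "\<And>C. C \<subseteq> B \<Longrightarrow> C \<noteq> {} \<Longrightarrow> (\<And>v e. e \<in> C \<Longrightarrow> v \<in> e \<Longrightarrow> \<exists>e'\<in>C. e' \<noteq> e \<and> v \<in> e') \<Longrightarrow> False"
    and "{} \<notin> B"
  shows "forest B"
  unfolding forest_def
proof (intro allI impI)
  fix C assume C: "C \<subseteq> B" "C \<noteq> {}"
  show "\<exists>v. \<exists>!e. e \<in> C \<and> v \<in> e"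
  proof (rule ccontr)
    assume no: "\<not> ?thesis"
    have "\<exists>e'\<in>C. e' \<noteq> e \<and> v \<in> e'" if "e \<in> C" "v \<in> e" for v e
      using no that by (metis (no_types, lifting))
    then show False by (rule assms(1)[OF C])
  qed
qed

text \<open>The shortest cycle of a simple graph has three edges: leaving an edge at both ends with
  only one further edge would double the first one.\<close>

lemma forest_if_card_less_3:
  assumes "\<And>e. e \<in> B \<Longrightarrow> card e = 2" "finite B" "card B < 3"
  shows "forest B"
proof (rule forestI)
  fix C assume C: "C \<subseteq> B" "C \<noteq> {}" and nl: "\<And>v e. e \<in> C \<Longrightarrow> v \<in> e \<Longrightarrow> \<exists>e'\<in>C. e' \<noteq> e \<and> v \<in> e'"
  obtain e1 where e1: "e1 \<in> C" using C by blast
  obtain x y where xy: "e1 = {x, y}" "x \<noteq> y"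
    using assms(1) e1 C by (metis card_2_iff subsetD)
  obtain e2 where e2: "e2 \<in> C" "e2 \<noteq> e1" "x \<in> e2" using nl[OF e1] xy by blast
  have "C = {e1, e2}"
  proof (rule ccontr)
    assume "C \<noteq> {e1, e2}"
    then obtain e3 where "e3 \<in> C" "e3 \<noteq> e1" "e3 \<noteq> e2" using e1 e2 by blast
    then have "{e1, e2, e3} \<subseteq> B" "card {e1, e2, e3} = 3" using e1 e2 C by auto
    then show False using assms(3) card_mono[OF assms(2), of "{e1, e2, e3}"] by simp
  qed
  then have "y \<in> e2" using nl[OF e1, of y] xy by blast
  moreover have "card e2 = 2" using e2 C assms(1) by blast
  ultimately have "e2 = e1" using e2(3) xy by (auto simp: card_2_iff)
  then show False using e2 by simp
qed (use assms(1)[of "{}"] in auto)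

text \<open>Without leaves, an edge extends at both ends to a path of three edges. By bipartiteness
  the outer ends of this path differ from its inner vertices, so continuing at one of them takes a
  fourth edge.\<close>

lemma forest_if_bipartite_card_less_4:
  assumes bip: "\<And>e. e \<in> B \<Longrightarrow> \<exists>x y. e = {x, y} \<and> x \<in> P \<and> y \<notin> P" and "finite B" "card B < 4"
  shows "forest B"
proof (rule forestI)
  fix C assume C: "C \<subseteq> B" "C \<noteq> {}" and nl: "\<And>v e. e \<in> C \<Longrightarrow> v \<in> e \<Longrightarrow> \<exists>e'\<in>C. e' \<noteq> e \<and> v \<in> e'"
  obtain e1 where e1: "e1 \<in> C" using C by blast
  obtain x y where xy: "e1 = {x, y}" "x \<in> P" "y \<notin> P" using bip e1 C by blast
  obtain e2 where e2: "e2 \<in> C" "e2 \<noteq> e1" "x \<in> e2" using nl[OF e1] xy by blast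
  obtain e3 where e3: "e3 \<in> C" "e3 \<noteq> e1" "y \<in> e3" using nl[OF e1] xy by blast
  obtain y2 where y2: "e2 = {x, y2}" "y2 \<notin> P" using bip[of e2] e2 C xy(2) by blast
  obtain x3 where x3: "e3 = {x3, y}" "x3 \<in> P" using bip[of e3] e3 C xy(3) by blast
  have ne: "y2 \<noteq> y" "x3 \<noteq> x" "e2 \<noteq> e3" using y2 x3 xy e2 e3 by auto
  obtain e4 where e4: "e4 \<in> C" "e4 \<noteq> e2" "y2 \<in> e4" using nl[OF e2(1)] y2 by blast
  have "e4 \<noteq> e1" "e4 \<noteq> e3" using e4 ne xy y2 x3 by auto
  then have "card {e1, e2, e3, e4} = 4" "{e1, e2, e3, e4} \<subseteq> B"
    using e1 e2 e3 e4 ne C by auto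
  then show False using assms(3) card_mono[OF assms(2), of "{e1, e2, e3, e4}"] by simp
qed (use bip[of "{}"] in auto)

section \<open>Edge counts and excluded subgraphs of planar graphs\<close>

definition nbrs :: "graph \<Rightarrow> nat \<Rightarrow> nat set" where
  "nbrs G v = {u. {u, v} \<in> edges G}"

lemma nbrs_sym: "u \<in> nbrs G v \<longleftrightarrow> v \<in> nbrs G u"
  by (simp add: nbrs_def insert_commute)

context
  fixes G assumes wf: "wf_graph G"
begin

lemma finite_verts: "finite (verts G)"
  using wf by (simp add: wf_graph_def)

lemma nbrs_irrefl: "v \<notin> nbrs G v"
  using wf by (force simp: wf_graph_def nbrs_def)

lemma nbrs_subset: "nbrs G v \<subseteq> verts G"
  using wf by (auto simp: wf_graph_def nbrs_def)

lemma nbrs_verts: "u \<in> nbrs G v \<Longrightarrow> v \<in> verts G"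
  using nbrs_subset nbrs_sym by blast

lemma finite_nbrs: "finite (nbrs G v)"
  by (rule finite_subset[OF nbrs_subset finite_verts])

lemma finite_edges_G: "finite (edges G)"
proof (rule finite_subset)
  show "edges G \<subseteq> Pow (verts G)" using wf by (auto simp: wf_graph_def)
qed (simp add: finite_verts)

lemma handshake:
  assumes S: "S \<subseteq> verts G"
  shows "(\<Sum>v\<in>S. card (nbrs G v \<inter> S)) = 2 * card {e \<in> edges G. e \<subseteq> S}"
proof -
  let ?E = "{e \<in> edges G. e \<subseteq> S}"
  have fin: "finite S" "finite ?E" using finite_subset[OF S finite_verts] finite_edges_G by auto
  have "card (nbrs G v \<inter> S) = card {e \<in> ?E. v \<in> e}" if "v \<in> S" for v
  proof (rule bij_betw_same_card)
    show "bij_betw (\<lambda>u. {u, v}) (nbrs G v \<inter> S) {e \<in> ?E. v \<in> e}"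
      unfolding bij_betw_def
    proof
      show "inj_on (\<lambda>u. {u, v}) (nbrs G v \<inter> S)" by (auto simp: inj_on_def doubleton_eq_iff)
      show "(\<lambda>u. {u, v}) ` (nbrs G v \<inter> S) = {e \<in> ?E. v \<in> e}"
      proof
        show "{e \<in> ?E. v \<in> e} \<subseteq> (\<lambda>u. {u, v}) ` (nbrs G v \<inter> S)"
        proof
          fix e assume e: "e \<in> {e \<in> ?E. v \<in> e}"
          then have "card e = 2" using wf by (auto simp: wf_graph_def)
          then obtain u where "e = {u, v}" using e by (auto simp: card_2_iff)
          then show "e \<in> (\<lambda>u. {u, v}) ` (nbrs G v \<inter> S)" using e by (auto simp: nbrs_def)
        qed
      qed (use that in \<open>auto simp: nbrs_def\<close>)
    qed
  qed
  then have "(\<Sum>v\<in>S. card (nbrs G v \<inter> S)) = (\<Sum>v\<in>S. \<Sum>e\<in>?E. if v \<in> e then 1 else 0)"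
    using fin by (simp add: sum.If_cases Int_def)
  also have "\<dots> = (\<Sum>e\<in>?E. \<Sum>v\<in>S. if v \<in> e then 1 else 0)" by (rule sum.swap)
  also have "\<dots> = (\<Sum>e\<in>?E. 2)"
  proof (rule sum.cong)
    fix e assume e: "e \<in> ?E"
    then have "S \<inter> {v. v \<in> e} = e" by auto
    then show "(\<Sum>v\<in>S. if v \<in> e then 1 else 0) = (2::nat)"
      using fin e wf by (auto simp: sum.If_cases wf_graph_def)
  qed simp
  finally show ?thesis by simp
qed

context
  assumes pl: "planar G"
begin

text \<open>The Euler inequality with every edge counted and girth bound 3.\<close>

lemma planar_density:
  assumes "S \<subseteq> verts G"
  shows "card {e \<in> edges G. e \<subseteq> S} \<le> 3 * card S"
proof -
  let ?E = "{e \<in> edges G. e \<subseteq> S}"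
  have "3 * card ?E \<le> 2 * card ?E + 3 * card S"
  proof (rule planar_weighted_Euler[OF wf pl])
    fix B assume "B \<subseteq> ?E" "card (B \<inter> ?E) < 3"
    then show "forest B"
      using wf finite_subset[OF _ finite_edges_G, of B]
      by (intro forest_if_card_less_3) (auto simp: wf_graph_def Int_absorb2)
  qed (use assms in auto)
  then show ?thesis by simp
qed

text \<open>With girth bound 4, a bipartite planar graph has at most twice as many edges as
  vertices, but a complete bipartite graph on 3 and 7 vertices has 21 edges and 10 vertices.\<close>

lemma planar_K37:
  assumes "a \<noteq> b" "a \<noteq> c" "b \<noteq> c"
  shows "card (nbrs G a \<inter> nbrs G b \<inter> nbrs G c) \<le> 6"
proof (rule ccontr)
  assume "\<not> ?thesis"
  then have "7 \<le> card (nbrs G a \<inter> nbrs G b \<inter> nbrs G c)" by simp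
  then obtain M where M: "M \<subseteq> nbrs G a \<inter> nbrs G b \<inter> nbrs G c" "card M = 7"
    by (meson obtain_subset_with_card_n)
  define T where "T = {a, b, c}"
  have MT: "M \<inter> T = {}" using M nbrs_irrefl by (auto simp: T_def)
  have cT: "card T = 3" "finite T" using assms by (auto simp: T_def)
  have fM: "finite M" using M(2) by (metis card.infinite zero_neq_numeral)
  let ?h = "\<lambda>(x, m). {x, m}"
  define E where "E = ?h ` (T \<times> M)"
  have inj: "inj_on ?h (T \<times> M)"
    using MT by (auto simp: inj_on_def doubleton_eq_iff)
  have cE: "card E = 21" unfolding E_def card_image[OF inj] by (simp add: card_cartesian_product cT M)
  have EG: "E \<subseteq> edges G" using M by (auto simp: E_def T_def nbrs_def insert_commute)
  have "4 * card E \<le> 2 * card E + 4 * card (T \<union> M)"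
  proof (rule planar_weighted_Euler[OF wf pl EG])
    show "T \<union> M \<subseteq> verts G"
    proof -
      obtain m where "m \<in> M" using M(2) by fastforce
      then have "a \<in> verts G" "b \<in> verts G" "c \<in> verts G" using M(1) nbrs_verts by blast+
      then show ?thesis using M(1) nbrs_subset by (auto simp: T_def)
    qed
    fix B assume B: "B \<subseteq> E" "card (B \<inter> E) < 4"
    show "forest B"
    proof (rule forest_if_bipartite_card_less_4[of B T])
      show "finite B" using finite_subset[OF order_trans[OF B(1) EG] finite_edges_G] .
      show "card B < 4" using B by (simp add: Int_absorb2)
      show "\<exists>x y. e = {x, y} \<and> x \<in> T \<and> y \<notin> T" if "e \<in> B" for e
      proof -
        obtain x m where "e = {x, m}" "x \<in> T" "m \<in> M" using \<open>e \<in> B\<close> B(1) by (auto simp: E_def)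
        then show ?thesis using MT by blast
      qed
    qed
  qed (auto simp: E_def)
  moreover have "card (T \<union> M) = 10" using cT fM M(2) MT by (simp add: card_Un_disjoint Int_commute)
  ultimately show False using cE by simp
qed

text \<open>
  Contracting the stars of the dominators yields a simple planar graph on \<open>Q \<union> D\<close>; in it, edges inside
  \<open>Q\<close> are counted twice by the degrees of the vertices of \<open>Q\<close>.
\<close>

lemma many_dominators:
  assumes D: "D \<subseteq> verts G" and Q: "Q \<subseteq> verts G - D"
    and d: "\<And>u. u \<in> D \<Longrightarrow> d u = u" "\<And>u. u \<in> verts G - D \<Longrightarrow> d u \<in> D \<and> d u \<in> nbrs G u"
    and K: "\<And>v. v \<in> Q \<Longrightarrow> K \<le> card (d ` nbrs G v)"
  shows "K * card Q \<le> 6 * card Q + 3 * card D"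
proof -
  \<comment> \<open>One neighbour outside \<open>Q\<close> is kept for each dominator seen there, so
    that the contraction creates no parallel edges.\<close>
  have "\<exists>U. U \<subseteq> nbrs G v - Q \<and> inj_on d U \<and> d ` (nbrs G v - Q) = d ` U" for v
    using subset_image_inj[of "d ` (nbrs G v - Q)" d "nbrs G v - Q"] by blast
  then obtain s where s: "\<And>v. s v \<subseteq> nbrs G v - Q" "\<And>v. inj_on d (s v)" "\<And>v. d ` (nbrs G v - Q) = d ` s v"
    by metis
  have fin: "finite D" "finite Q" "\<And>v. finite (s v)"
  proof -
    show "finite D" by (rule finite_subset[OF D finite_verts])
    show "finite Q" by (rule finite_subset[OF _ finite_verts]) (use Q in blast)
    show "finite (s v)" for v by (rule finite_subset[OF _ finite_nbrs[of v]]) (use s in blast)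
  qed
  \<comment> \<open>Kept neighbours in \<open>D\<close> are their own dominators and have no spoke
    to contract.\<close>
  define U where "U = (\<Union>v\<in>Q. s v) - D"
  have finU: "finite U" using fin by (simp add: U_def)
  have UV: "U \<subseteq> verts G - D" "U \<inter> Q = {}" using s(1) nbrs_subset by (auto simp: U_def)
  have dU: "d u \<in> D" "{u, d u} \<in> edges G" if "u \<in> U" for u
    using d(2)[of u] UV that by (auto simp: nbrs_def insert_commute)
  define Sel where "Sel = (\<lambda>(v, u). {v, u}) ` (SIGMA v:Q. s v)"
  define QQ where "QQ = {e \<in> edges G. e \<subseteq> Q}"
  \<comment> \<open>The spokes to be contracted; they stay outside the counted set
    \<open>R\<close>.\<close>
  define Sp where "Sp = (\<lambda>u. {u, d u}) ` U"
  define R where "R = Sel \<union> QQ"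
  have SelG: "Sel \<subseteq> edges G" using s(1) by (auto simp: Sel_def nbrs_def insert_commute)
  have SpG: "Sp \<subseteq> edges G" using dU by (auto simp: Sp_def)
  have EG: "R \<union> Sp \<subseteq> edges G" using SelG SpG by (auto simp: R_def QQ_def)
  have fR: "finite R" "finite Sp" "finite Sel" "finite QQ"
    using finite_subset[OF _ finite_edges_G] EG by (auto simp: R_def)
  have spQ: "e \<inter> Q = {}" if "e \<in> Sp" for e using that UV Q dU by (auto simp: Sp_def)
  have c2: "card e = 2" if "e \<in> R \<union> Sp" for e
    using that EG wf by (auto simp: wf_graph_def)
  have RQ: "\<exists>v x. e = {v, x} \<and> v \<in> Q \<and> x \<noteq> v" if "e \<in> R" for e
  proof -
    have "card e = 2" using c2 that by blast
    moreover have "e \<inter> Q \<noteq> {}"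
    proof (cases "e \<in> QQ")
      case True
      then have "e \<inter> Q = e" by (auto simp: QQ_def)
      then show ?thesis using \<open>card e = 2\<close> by auto
    qed (use that in \<open>auto simp: R_def Sel_def\<close>)
    ultimately show ?thesis by (auto simp: card_2_iff)
  qed
  have selD: "x \<in> s v" if "{v, x} \<in> R" "v \<in> Q" "x \<notin> Q" for v x
    using that s(1) by (auto simp: R_def QQ_def Sel_def doubleton_eq_iff)
  have "3 * card (R \<union> Sp) \<le> 2 * card R + 3 * card (Q \<union> D \<union> U)"
  proof (rule planar_weighted_Euler[OF wf pl EG])
    show "Q \<union> D \<union> U \<subseteq> verts G" using Q D UV by auto
    show "e \<subseteq> Q \<union> D \<union> U" if "e \<in> R \<union> Sp" for e
      using that dU by (auto simp: R_def Sel_def QQ_def Sp_def U_def)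
    \<comment> \<open>A leafless set contains an edge of \<open>R\<close>, hence two of them at a
      common \<open>v\<close> in \<open>Q\<close>. If there are only two, their other ends lie
      outside \<open>Q\<close> and have distinct dominators, so spokes alone cannot close the
      cycle.\<close>
    fix B assume B: "B \<subseteq> R \<union> Sp" "card (B \<inter> R) < 3"
    show "forest B"
    proof (rule forestI)
      show "{} \<notin> B" using c2[of "{}"] B(1) by auto
      fix C assume C: "C \<subseteq> B" "C \<noteq> {}" and nl: "\<And>v e. e \<in> C \<Longrightarrow> v \<in> e \<Longrightarrow> \<exists>e'\<in>C. e' \<noteq> e \<and> v \<in> e'"
      have spoke: "\<exists>e\<in>C \<inter> R. u \<in> e" if u: "u \<in> U" "{u, d u} \<in> C" for u
      proof -
        obtain e where e: "e \<in> C" "e \<noteq> {u, d u}" "u \<in> e" using nl[OF u(2), of u] by blast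
        moreover have "e \<notin> Sp"
        proof
          assume "e \<in> Sp"
          then obtain u' where "u' \<in> U" "e = {u', d u'}" by (auto simp: Sp_def)
          then show False using e u(1) dU(1) UV by auto
        qed
        ultimately show ?thesis using C B by blast
      qed
      have "C \<inter> R \<noteq> {}"
      proof
        assume "C \<inter> R = {}"
        then obtain e where "e \<in> C" "e \<in> Sp" using C B by blast
        then show False using spoke \<open>C \<inter> R = {}\<close> by (auto simp: Sp_def)
      qed
      then obtain e1 where e1: "e1 \<in> C" "e1 \<in> R" by blast
      then obtain v x1 where x1: "e1 = {v, x1}" "v \<in> Q" "x1 \<noteq> v" using RQ by blast
      have inR: "e \<in> R" if "e \<in> C" "w \<in> e" "w \<in> Q" for e w using that spQ C B by blast
      obtain e2 where e2: "e2 \<in> C" "e2 \<noteq> e1" "v \<in> e2" using nl[OF e1(1), of v] x1 by blast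
      have e2R: "e2 \<in> R" using inR e2 x1 by blast
      have "card e2 = 2" using c2 e2R by blast
      then obtain x2 where x2: "e2 = {v, x2}" "x2 \<noteq> v" using e2(3) by (auto simp: card_2_iff)
      have x12: "x1 \<noteq> x2" using e2(2) x1 x2 by auto
      have only: "e = e1 \<or> e = e2" if "e \<in> C" "e \<in> R" for e
      proof (rule ccontr)
        assume "\<not> ?thesis"
        then have "e1 \<notin> {e2, e}" "e2 \<noteq> e" using e2(2) by blast+
        then have "card {e1, e2, e} = 3" by simp
        moreover have "{e1, e2, e} \<subseteq> B \<inter> R" using that C e1 e2 e2R by auto
        ultimately show False using B(2) card_mono[of "B \<inter> R" "{e1, e2, e}"] fR(1) by simp
      qed
      have nQ: "x1 \<notin> Q" "x2 \<notin> Q"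
      proof -
        show "x1 \<notin> Q"
        proof
          assume "x1 \<in> Q"
          moreover obtain e where "e \<in> C" "e \<noteq> e1" "x1 \<in> e" using nl[OF e1(1), of x1] x1 by blast
          ultimately have "x1 \<in> e2" using inR only by blast
          then show False using x2 x1 x12 by auto
        qed
        show "x2 \<notin> Q"
        proof
          assume "x2 \<in> Q"
          moreover obtain e where "e \<in> C" "e \<noteq> e2" "x2 \<in> e" using nl[OF e2(1), of x2] x2 by blast
          ultimately have "x2 \<in> e1" using inR only by blast
          then show False using x2 x1 x12 by auto
        qed
      qed
      have xs: "x1 \<in> s v" "x2 \<in> s v" using selD e1 e2R x1 x2 nQ by blast+
      then have dne: "d x1 \<noteq> d x2" using s(2)[of v] x12 by (auto simp: inj_on_def)
      obtain e3 where e3: "e3 \<in> C" "e3 \<noteq> e1" "x1 \<in> e3" using nl[OF e1(1), of x1] x1 by blast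
      have spoke': "u = x1 \<or> u = x2" if "u \<in> U" "{u, d u} \<in> C" for u
        using spoke[OF that] only x1 x2 that(1) UV(2) by blast
      have "e3 \<noteq> e2" using e3 x2 x1 x12 by auto
      then have "e3 \<notin> R" using only e3 by blast
      then obtain u where u: "u \<in> U" "e3 = {u, d u}" using e3 C B by (auto simp: Sp_def)
      show False
      proof (cases "x1 = u")
        case True
        have vD: "d u \<in> D" "d u \<notin> Q" "d u \<notin> U" using dU(1)[OF u(1)] Q UV(1) by auto
        obtain e4 where e4: "e4 \<in> C" "e4 \<noteq> e3" "d u \<in> e4" using nl[OF e3(1), of "d u"] u by blast
        have "e4 \<noteq> e1" using e4 x1 vD x1(2) u(1) True by auto
        moreover have "e4 \<noteq> e2"
        proof
          assume "e4 = e2"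
          then have "x2 = d u" using e4 x2 vD x1(2) by auto
          then show False using d(1)[of x2] vD dne True by auto
        qed
        ultimately have "e4 \<in> Sp" using only e4 C B by blast
        then obtain u' where u': "u' \<in> U" "e4 = {u', d u'}" by (auto simp: Sp_def)
        then have "d u = d u'" using e4 vD by auto
        moreover have "u' = x1 \<or> u' = x2" using spoke' u' e4 by blast
        ultimately show False using True dne e4 u u' by auto
      next
        case False
        then have "x1 = d u" using e3 u by auto
        moreover have "u = x2" using spoke'[of u] u e3 False by auto
        ultimately show False using dne d(1)[of x1] dU(1)[OF u(1)] by auto
      qed
    qed
  qed simp
  moreover have "R \<inter> Sp = {}" using RQ spQ by blast
  then have "card (R \<union> Sp) = card R + card Sp" using fR by (simp add: card_Un_disjoint)
  moreover have "inj_on (\<lambda>u. {u, d u}) U"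
    using UV(1) dU(1) by (auto simp: inj_on_def doubleton_eq_iff)
  then have "card Sp = card U" unfolding Sp_def by (rule card_image)
  moreover have "card (Q \<union> D \<union> U) \<le> card Q + card D + card U"
    by (meson card_Un_le add_le_mono le_trans order_refl)
  \<comment> \<open>Each spoke comes with its own vertex of \<open>U\<close>, so both cancel and the
    bound for the contracted graph remains.\<close>
  ultimately have cR: "card R \<le> 3 * card Q + 3 * card D" by simp
  have "Sel \<inter> QQ = {}" using s(1) by (auto simp: Sel_def QQ_def)
  then have R2: "card R = card Sel + card QQ" unfolding R_def using fR by (simp add: card_Un_disjoint)
  have "inj_on (\<lambda>(v, u). {v, u}) (SIGMA v:Q. s v)"
    using s(1) by (force simp: inj_on_def doubleton_eq_iff)
  then have cSel: "card Sel = (\<Sum>v\<in>Q. card (s v))"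
    unfolding Sel_def using fin by (simp add: card_image)
  have cQQ: "(\<Sum>v\<in>Q. card (nbrs G v \<inter> Q)) = 2 * card QQ" "card QQ \<le> 3 * card Q"
    unfolding QQ_def using handshake planar_density Q by auto
  have "K \<le> card (s v) + card (nbrs G v \<inter> Q)" if "v \<in> Q" for v
  proof -
    have "d ` nbrs G v \<subseteq> d ` s v \<union> d ` (nbrs G v \<inter> Q)" using s(3)[of v] by blast
    then have "card (d ` nbrs G v) \<le> card (d ` s v \<union> d ` (nbrs G v \<inter> Q))"
      using fin finite_nbrs by (intro card_mono) auto
    also have "\<dots> \<le> card (d ` s v) + card (d ` (nbrs G v \<inter> Q))" by (rule card_Un_le)
    also have "\<dots> \<le> card (s v) + card (nbrs G v \<inter> Q)"
      using fin finite_nbrs by (intro add_mono card_image_le) auto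
    finally show ?thesis using K[OF that] by simp
  qed
  then have "(\<Sum>v\<in>Q. K) \<le> (\<Sum>v\<in>Q. card (s v) + card (nbrs G v \<inter> Q))" by (rule sum_mono)
  \<comment> \<open>The degree sum counts edges inside \<open>Q\<close> twice and \<open>R\<close>
    counts them once. The surplus of at most \<open>3 * card Q\<close> turns the coefficient 3 into
    6.\<close>
  then have "K * card Q \<le> card Sel + 2 * card QQ"
    using cSel cQQ by (simp add: sum.distrib mult.commute)
  then show ?thesis using R2 cR cQQ(2) by simp
qed

end
end

text \<open>The bound on each superlevel set of \<open>f\<close> is integrated over all levels.\<close>

lemma sum_min_le_of_density:
  fixes f :: "'a \<Rightarrow> real"
  assumes V: "finite V" and A: "A \<subseteq> V \<times> V" and c: "\<And>S. S \<subseteq> V \<Longrightarrow> real (card (A \<inter> S \<times> S)) \<le> c * real (card S)"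
    and "\<And>v. v \<in> V \<Longrightarrow> 0 \<le> f v"
  shows "(\<Sum>(u, v)\<in>A. min (f u) (f v)) \<le> c * (\<Sum>v\<in>V. f v)"
  using assms(4)
proof (induction "card {v \<in> V. 0 < f v}" arbitrary: f rule: less_induct)
  case less
  let ?P = "{v \<in> V. 0 < f v}"
  have fA: "finite A" using A V finite_subset[OF A] by simp
  show ?case
  proof (cases "?P = {}")
    case True
    then have "f v = 0" if "v \<in> V" for v using less.prems[OF that] that by force
    then have "(\<Sum>(u, v)\<in>A. min (f u) (f v)) = 0" "(\<Sum>v\<in>V. f v) = 0"
      using A by (auto intro!: sum.neutral)
    then show ?thesis by simp
  next
    case False
    have fP: "finite ?P" using V by simp
    \<comment> \<open>\<open>m\<close> is the height of the lowest level. Subtracting it on the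
      support of \<open>f\<close> makes the support smaller, and exactly the pairs inside the
      support lose \<open>m\<close>, which the density hypothesis pays for.\<close>
    define m where "m = Min (f ` ?P)"
    have m: "m \<le> f v" if "v \<in> ?P" for v using that fP by (simp add: m_def)
    have "m \<in> f ` ?P" unfolding m_def using fP False by (intro Min_in) auto
    then obtain w where w: "w \<in> ?P" "f w = m" by auto
    define g where "g v = (if v \<in> ?P then f v - m else f v)" for v
    have g0: "0 \<le> g v" if "v \<in> V" for v using that m less.prems by (auto simp: g_def)
    have "{v \<in> V. 0 < g v} \<subset> ?P" using w by (auto simp: g_def split: if_splits)
    then have IH: "(\<Sum>(u, v)\<in>A. min (g u) (g v)) \<le> c * (\<Sum>v\<in>V. g v)"
      using less.hyps[of g] psubset_card_mono[OF fP] g0 by blast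
    have pt: "min (f u) (f v) = min (g u) (g v) + (if (u, v) \<in> ?P \<times> ?P then m else 0)" if "(u, v) \<in> A" for u v
    proof -
      have uv: "u \<in> V" "v \<in> V" using that A by auto
      then have "0 \<le> f u" "0 \<le> f v" "0 \<le> g u" "0 \<le> g v" using less.prems g0 by auto
      then show ?thesis using uv m[of u] m[of v] by (auto simp: g_def min_def)
    qed
    have "(\<Sum>(u, v)\<in>A. min (f u) (f v)) = (\<Sum>z\<in>A. (case z of (u, v) \<Rightarrow> min (g u) (g v)) + (if z \<in> ?P \<times> ?P then m else 0))"
    proof (rule sum.cong)
      fix z assume "z \<in> A"
      then show "(case z of (u, v) \<Rightarrow> min (f u) (f v)) =
          (case z of (u, v) \<Rightarrow> min (g u) (g v)) + (if z \<in> ?P \<times> ?P then m else 0)"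
        using pt[of "fst z" "snd z"] by (simp only: case_prod_unfold prod.collapse)
    qed simp
    also have "\<dots> = (\<Sum>(u, v)\<in>A. min (g u) (g v)) + m * real (card (A \<inter> ?P \<times> ?P))"
      using fA by (simp add: sum.distrib sum.inter_restrict[symmetric])
    also have "\<dots> \<le> c * (\<Sum>v\<in>V. g v) + m * (c * real (card ?P))"
      using IH c[of ?P] w by (intro add_mono mult_left_mono) auto
    also have "\<dots> = c * (\<Sum>v\<in>V. g v + (if v \<in> ?P then m else 0))"
    proof -
      have "(\<Sum>v\<in>V. if v \<in> ?P then m else 0) = (\<Sum>v\<in>V \<inter> ?P. m)"
        using V by (simp only: sum.inter_restrict)
      also have "V \<inter> ?P = ?P" by blast
      finally show ?thesis by (simp add: sum.distrib distrib_left mult.commute mult.left_commute)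
    qed
    also have "(\<Sum>v\<in>V. g v + (if v \<in> ?P then m else 0)) = (\<Sum>v\<in>V. f v)"
      by (rule sum.cong) (auto simp: g_def)
    finally show ?thesis .
  qed
qed

section \<open>The algorithm and its locality\<close>

definition cnbrs :: "graph \<Rightarrow> nat \<Rightarrow> nat set" where
  "cnbrs G v = insert v (nbrs G v)"

lemma cnbrs_sym: "u \<in> cnbrs G v \<longleftrightarrow> v \<in> cnbrs G u"
  using nbrs_sym by (auto simp: cnbrs_def)

text \<open>\<open>A\<close> ranges over all finite sets of identifiers. Only members within
  distance 2 of \<open>v\<close> can dominate a neighbour of \<open>v\<close>, so the condition
  remains local.\<close>

definition phase1 :: "graph \<Rightarrow> nat \<Rightarrow> bool" where
  "phase1 G v \<longleftrightarrow> \<not> (\<exists>A. finite A \<and> card A \<le> 7 \<and> v \<notin> A \<and> (\<forall>u\<in>nbrs G v. u \<in> A \<or> nbrs G u \<inter> A \<noteq> {}))"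

definition rest1 :: "graph \<Rightarrow> nat \<Rightarrow> bool" where
  "rest1 G u \<longleftrightarrow> (\<forall>w\<in>cnbrs G u. \<not> phase1 G w)"

text \<open>Adjacency to \<open>w\<close> is tested from \<open>u\<close>, so \<open>v\<close> can
  evaluate this without exploring the surroundings of \<open>w\<close>.\<close>

definition common :: "graph \<Rightarrow> nat \<Rightarrow> nat \<Rightarrow> nat set" where
  "common G v w = {u \<in> nbrs G v. w \<in> nbrs G u \<and> rest1 G u}"

text \<open>The threshold is 7 times 8: a third vertex dominates at most 7 common neighbours, namely
  itself and the 6 allowed by \<open>planar_K37\<close>, so dominating 56 of them from outside the
  pair takes 8 vertices.\<close>

definition phase2 :: "graph \<Rightarrow> nat \<Rightarrow> bool" where
  "phase2 G v \<longleftrightarrow> (\<exists>w. w \<noteq> v \<and> 56 \<le> card (common G v w))"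

definition rest2 :: "graph \<Rightarrow> nat \<Rightarrow> bool" where
  "rest2 G u \<longleftrightarrow> (\<forall>w\<in>cnbrs G u. \<not> phase1 G w \<and> \<not> phase2 G w)"

text \<open>
  The initial weight makes all loads at most \<open>393 * (1/8 * (7/8) ^ 30) \<le> 1\<close>, and after 30 rounds the
  vertices that are still uncovered have weight exactly 1/8.
\<close>

primrec weight :: "graph \<Rightarrow> nat \<Rightarrow> nat \<Rightarrow> real" where
  "weight G 0 u = (if rest2 G u then 1/8 * (7/8) ^ 30 else 0)"
| "weight G (Suc i) u =
    (if \<forall>w\<in>cnbrs G u. (\<Sum>x\<in>cnbrs G w. weight G i x) < 7/8 then 8/7 * weight G i u else weight G i u)"

definition load :: "graph \<Rightarrow> nat \<Rightarrow> nat \<Rightarrow> real" where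
  "load G i w = (\<Sum>x\<in>cnbrs G w. weight G i x)"

definition uncovered :: "graph \<Rightarrow> nat \<Rightarrow> bool" where
  "uncovered G u \<longleftrightarrow> rest2 G u \<and> (\<forall>w\<in>cnbrs G u. load G 30 w < 7/8)"

definition selected :: "graph \<Rightarrow> nat \<Rightarrow> bool" where
  "selected G v \<longleftrightarrow> phase1 G v \<or> phase2 G v \<or> 7/8 \<le> load G 30 v \<or> uncovered G v"

text \<open>Recursive equality of neighbourhoods replaces equality of views: each quantifier over
  closed neighbours in a definition then costs one level, and radii add up along the
  definitions.\<close>

primrec agree :: "nat \<Rightarrow> graph \<Rightarrow> graph \<Rightarrow> nat \<Rightarrow> bool" where
  "agree 0 G H v \<longleftrightarrow> True"
| "agree (Suc r) G H v \<longleftrightarrow> nbrs G v = nbrs H v \<and> (\<forall>u\<in>cnbrs G v. agree r G H u)"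

lemma agree_SucD:
  assumes "agree (Suc r) G H v"
  shows "nbrs G v = nbrs H v" "cnbrs G v = cnbrs H v" "u \<in> cnbrs H v \<Longrightarrow> agree r G H u"
  using assms by (auto simp: cnbrs_def)

lemma agree_mono: "agree r G H v \<Longrightarrow> s \<le> r \<Longrightarrow> agree s G H v"
proof (induction s arbitrary: r v)
  case (Suc s)
  then obtain r' where r: "r = Suc r'" "s \<le> r'" by (metis Suc_le_D Suc_le_mono)
  then show ?case using Suc.prems(1) Suc.IH[of r'] by auto
qed simp

lemma phase1_local:
  assumes "agree 2 G H v" shows "phase1 G v \<longleftrightarrow> phase1 H v"
proof -
  have a: "agree (Suc (Suc 0)) G H v" using assms by (simp add: numeral_2_eq_2)
  have "nbrs G u = nbrs H u" if "u \<in> nbrs H v" for u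
    using agree_SucD(1)[OF agree_SucD(3)[OF a, of u]] that by (simp add: cnbrs_def)
  then show ?thesis using agree_SucD(1)[OF a] by (simp add: phase1_def)
qed

lemma rest1_local:
  assumes "agree 3 G H v" shows "rest1 G v \<longleftrightarrow> rest1 H v"
proof -
  have a: "agree (Suc 2) G H v" using assms by (simp add: numeral_3_eq_3 numeral_2_eq_2)
  show ?thesis unfolding rest1_def using agree_SucD(2)[OF a] phase1_local[OF agree_SucD(3)[OF a]] by simp
qed

lemma phase2_local:
  assumes "agree 4 G H v" shows "phase2 G v \<longleftrightarrow> phase2 H v"
proof -
  have a: "agree (Suc 3) G H v" using assms by (simp add: eval_nat_numeral)
  have "agree 3 G H u" if "u \<in> nbrs H v" for u
    using agree_SucD(3)[OF a, of u] that by (simp add: cnbrs_def)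
  then have "rest1 G u = rest1 H u" "nbrs G u = nbrs H u" if "u \<in> nbrs H v" for u
    using rest1_local that agree_SucD(1)[of 2 G H u] by (simp_all add: numeral_3_eq_3 numeral_2_eq_2)
  then have "common G v w = common H v w" for w
    unfolding common_def using agree_SucD(1)[OF a] by auto
  then show ?thesis by (simp add: phase2_def)
qed

lemma rest2_local:
  assumes "agree 5 G H v" shows "rest2 G v \<longleftrightarrow> rest2 H v"
proof -
  have a: "agree (Suc 4) G H v" using assms by (simp add: eval_nat_numeral)
  have "phase1 G u = phase1 H u" "phase2 G u = phase2 H u" if "u \<in> cnbrs H v" for u
    using phase2_local phase1_local agree_SucD(3)[OF a that] agree_mono[of 4 G H u 2] by simp_all
  then show ?thesis unfolding rest2_def using agree_SucD(2)[OF a] by simp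
qed

text \<open>A round inspects the loads of closed neighbours, which in turn read weights one step
  further away; hence two levels per round.\<close>

lemma weight_local: "agree (5 + 2 * i) G H v \<Longrightarrow> weight G i v = weight H i v"
proof (induction i arbitrary: v)
  case 0
  then show ?case using rest2_local by simp
next
  case (Suc i)
  have a: "agree (Suc (Suc (5 + 2 * i))) G H v" using Suc.prems by simp
  have "(\<Sum>x\<in>cnbrs G w. weight G i x) = (\<Sum>x\<in>cnbrs H w. weight H i x)" if w: "w \<in> cnbrs H v" for w
    using agree_SucD(2,3)[OF agree_SucD(3)[OF a w]] Suc.IH by (intro sum.cong) auto
  moreover have "weight G i v = weight H i v"
    using Suc.IH[OF agree_mono[OF Suc.prems]] by simp
  ultimately show ?case using agree_SucD(2)[OF a] by simp
qed

lemma load_local: "agree (6 + 2 * i) G H v \<Longrightarrow> load G i v = load H i v"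
  unfolding load_def using agree_SucD(2,3)[of "5 + 2 * i" G H v] weight_local[of i G H]
  by (intro sum.cong) auto

text \<open>The loads after 30 rounds have radius 66, and \<open>uncovered\<close> asks for them at
  the neighbours.\<close>

lemma selected_local:
  assumes "agree 67 G H v" shows "selected G v \<longleftrightarrow> selected H v"
proof -
  have "phase1 G v = phase1 H v" "phase2 G v = phase2 H v" "rest2 G v = rest2 H v" "load G 30 v = load H 30 v"
    using phase1_local phase2_local rest2_local load_local[of 30] agree_mono[OF assms] by simp_all
  moreover have a: "agree (Suc 66) G H v" using assms by simp
  have "load G 30 w = load H 30 w" if "w \<in> cnbrs H v" for w
    using load_local[of 30] agree_SucD(3)[OF a that] by simp
  then have "(\<forall>w\<in>cnbrs G v. load G 30 w < 7/8) = (\<forall>w\<in>cnbrs H v. load H 30 w < 7/8)"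
    using agree_SucD(2)[OF a] by simp
  ultimately show ?thesis by (simp add: selected_def uncovered_def)
qed

section \<open>From equal views to agreement\<close>

lemma dist_le_Cons:
  assumes "dist_le G u x k" "{v, u} \<in> edges G" "v \<in> verts G"
  shows "dist_le G v x (Suc k)"
  using assms
proof (induction G u x k rule: dist_le.induct)
  case (refl u G k)
  show ?case by (rule dist_le.step[OF dist_le.refl]) (use refl in auto)
next
  case (step G u y k w)
  then show ?case using dist_le.step by blast
qed

lemma dist_le_Suc: "dist_le G v x k \<Longrightarrow> dist_le G v x (Suc k)"
  by (induction rule: dist_le.induct) (auto intro: dist_le.intros)

text \<open>Every edge near \<open>u\<close> is in the common view of \<open>v\<close>. Walks of
  length at most \<open>r\<close> from \<open>u\<close> can therefore be copied edge by edge into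
  \<open>G'\<close>, which transfers distances as well as edges.\<close>

lemma local_view_subset:
  assumes eq: "local_view G v (Suc r) = local_view G' v (Suc r)" and u: "u \<in> verts G'"
    and near: "\<And>x k. dist_le G u x k \<Longrightarrow> dist_le G v x (Suc k)"
  shows "local_view G u r \<subseteq> local_view G' u r"
proof
  have edge: "e \<in> edges G'" if "e \<in> edges G" "x \<in> e" "dist_le G u x k" "k < r" for e x k
  proof -
    have "e \<in> local_view G v (Suc r)" unfolding local_view_def using near that by blast
    then show ?thesis using eq by (auto simp: local_view_def)
  qed
  have tr: "H = G \<Longrightarrow> y = u \<Longrightarrow> k \<le> r \<Longrightarrow> dist_le G' u x k" if "dist_le H y x k" for H y x k
    using that
  proof (induction H y x k rule: dist_le.induct)
    case (refl y H k)
    then show ?case using u by (auto intro: dist_le.refl)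
  next
    case (step H y x k w)
    then have "{x, w} \<in> edges G'" using edge[of "{x, w}" x k] by simp
    moreover have "dist_le G' u x k" using step by simp
    ultimately show ?case by (rule dist_le.step[rotated])
  qed
  fix e assume "e \<in> local_view G u r"
  then obtain x k where x: "e \<in> edges G" "x \<in> e" "k < r" "dist_le G u x k"
    by (auto simp: local_view_def)
  then have "e \<in> edges G'" "dist_le G' u x k" using edge tr[OF x(4)] by auto
  then show "e \<in> local_view G' u r" using x by (auto simp: local_view_def)
qed

text \<open>A view of radius \<open>Suc r\<close> determines the neighbours of \<open>v\<close> and
  their views of radius \<open>r\<close>.\<close>

lemma agree_if_local_view_eq:
  assumes wf: "wf_graph G" "wf_graph G'"
  shows "v \<in> verts G \<Longrightarrow> v \<in> verts G' \<Longrightarrow> local_view G v r = local_view G' v r \<Longrightarrow> agree r G G' v"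
proof (induction r arbitrary: v)
  case (Suc r)
  have iv: "{u, v} \<in> local_view H v (Suc r) \<longleftrightarrow> {u, v} \<in> edges H" if "v \<in> verts H" for H u
    using dist_le.refl[OF that] by (auto simp: local_view_def)
  have "{u, v} \<in> edges G \<longleftrightarrow> {u, v} \<in> edges G'" for u
    using iv[OF Suc.prems(1)] iv[OF Suc.prems(2)] Suc.prems(3) by simp
  then have nb: "nbrs G v = nbrs G' v" by (simp add: nbrs_def)
  have "agree r G G' u" if u: "u \<in> cnbrs G v" for u
  proof (rule Suc.IH)
    have e: "u = v \<or> {v, u} \<in> edges G \<and> {v, u} \<in> edges G'"
      using u nb by (auto simp: cnbrs_def nbrs_def insert_commute)
    show uV: "u \<in> verts G" "u \<in> verts G'" using e wf Suc.prems(1,2) by (auto simp: wf_graph_def)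
    have "dist_le G v x (Suc k)" if "dist_le G u x k" for x k
      using e dist_le_Suc dist_le_Cons that Suc.prems(1) by blast
    moreover have "dist_le G' v x (Suc k)" if "dist_le G' u x k" for x k
      using e dist_le_Suc dist_le_Cons that Suc.prems(2) by blast
    ultimately show "local_view G u r = local_view G' u r"
      using local_view_subset[OF Suc.prems(3) uV(2)] local_view_subset[OF Suc.prems(3)[symmetric] uV(1)]
      by (simp add: subset_antisym)
  qed
  then show ?case using nb by simp
qed simp

section \<open>Approximation guarantee\<close>

lemma card_UN_le_mult:
  assumes "finite A" "M \<subseteq> (\<Union>a\<in>A. B a)" "\<And>a. a \<in> A \<Longrightarrow> finite (B a) \<and> card (B a) \<le> c"
  shows "card M \<le> c * card A"
proof -
  have "card M \<le> card (\<Union>a\<in>A. B a)" using assms by (intro card_mono) auto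
  also have "\<dots> \<le> (\<Sum>a\<in>A. card (B a))" using assms(1) by (rule card_UN_le)
  also have "\<dots> \<le> (\<Sum>a\<in>A. c)" using assms(3) by (intro sum_mono) auto
  finally show ?thesis by (simp add: mult.commute)
qed

lemma common_sym: "common G v w = common G w v"
  unfolding common_def using nbrs_sym by blast

lemma common_nbrs: "common G v w \<subseteq> nbrs G v \<inter> nbrs G w"
  unfolding common_def using nbrs_sym by blast

lemma not_phase1_if_common: "common G v w \<noteq> {} \<Longrightarrow> \<not> phase1 G w"
  unfolding common_def rest1_def cnbrs_def by blast

section \<open>Growth of weights and loads\<close>

lemma weight_nonneg: "0 \<le> weight G i u"
  by (induction i) auto

lemma weight_mono: "weight G i u \<le> weight G (Suc i) u"
  using weight_nonneg[of G i u] by simp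

lemma load_mono: "load G i v \<le> load G (Suc i) v"
  unfolding load_def by (intro sum_mono weight_mono)

lemma weight_Suc:
  "weight G (Suc i) u = (if \<forall>w\<in>cnbrs G u. load G i w < 7/8 then 8/7 * weight G i u else weight G i u)"
  by (simp add: load_def)

lemma weight_zero: "\<not> rest2 G u \<Longrightarrow> weight G i u = 0"
  by (induction i) auto

lemma weight_le: "weight G i u \<le> 1/8 * (7/8) ^ 30 * (8/7) ^ i"
proof (induction i)
  case (Suc i)
  have "weight G (Suc i) u \<le> 8/7 * weight G i u" using weight_nonneg[of G i u] by simp
  also have "\<dots> \<le> 8/7 * (1/8 * (7/8) ^ 30 * (8/7) ^ i)" by (rule mult_left_mono[OF Suc]) simp
  finally show ?case by (simp add: mult_ac)
qed simp

lemma weight_le_eighth: "weight G 30 u \<le> 1/8"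
  using weight_le[of G 30 u] by (simp add: power_divide)

declare weight.simps(2) [simp del]

text \<open>Loads never decrease, so loads that are below the threshold now were below it in all
  earlier rounds, and the weight grew every time.\<close>

lemma weight_active:
  assumes "rest2 G u" "\<And>w. w \<in> cnbrs G u \<Longrightarrow> load G i w < 7/8"
  shows "weight G i u = 1/8 * (7/8) ^ 30 * (8/7) ^ i"
  using assms(2)
proof (induction i)
  case 0
  then show ?case using assms(1) by simp
next
  case (Suc i)
  have l: "load G i w < 7/8" if "w \<in> cnbrs G u" for w
    using Suc.prems[OF that] load_mono[of G i w] by linarith
  then have "weight G (Suc i) u = 8/7 * weight G i u" unfolding weight_Suc by simp
  also have "\<dots> = 8/7 * (1/8 * (7/8) ^ 30 * (8/7) ^ i)" by (simp only: Suc.IH[OF l])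
  finally show ?case by (simp add: mult_ac)
qed

text \<open>Below 7/8 the growth factor 8/7 cannot push the load beyond 1; from 7/8 on, all weights
  in the closed neighbourhood of \<open>v\<close> are frozen.\<close>

lemma load_step:
  assumes "load G i v \<le> 1" shows "load G (Suc i) v \<le> 1"
proof (cases "load G i v < 7/8")
  case True
  have "load G (Suc i) v \<le> (\<Sum>x\<in>cnbrs G v. 8/7 * weight G i x)"
    unfolding load_def using weight_nonneg[of G i] by (intro sum_mono) (simp add: weight_Suc)
  also have "\<dots> = 8/7 * load G i v" by (simp add: load_def sum_distrib_left)
  finally show ?thesis using True by simp
next
  case False
  have "weight G (Suc i) x = weight G i x" if "x \<in> cnbrs G v" for x
    using False that cnbrs_sym weight_Suc by metis
  then show ?thesis using assms by (simp add: load_def)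
qed

context
  fixes G assumes wf: "wf_graph G"
begin

lemma finite_cnbrs: "finite (cnbrs G v)"
  using finite_nbrs[OF wf] by (simp add: cnbrs_def)

lemma finite_common: "finite (common G v w)"
  using finite_subset[OF common_nbrs] finite_nbrs[OF wf] by blast

text \<open>The set \<open>A\<close> that keeps \<open>v\<close> out of phase 1 has at most 7
  members. Each accounts for itself and, as phase 2 fails at \<open>v\<close>, for at most 55 common
  neighbours. Adding \<open>v\<close> gives 7 times 56 plus 1.\<close>

lemma rest_degree: "card {u \<in> cnbrs G v. rest2 G u} \<le> 393"
proof (cases "phase1 G v \<or> phase2 G v")
  case True
  then have "{u \<in> cnbrs G v. rest2 G u} = {}" unfolding rest2_def using cnbrs_sym by blast
  then show ?thesis by (simp only: card.empty)
next
  case False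
  then obtain A where A: "finite A" "card A \<le> 7" "v \<notin> A" "\<And>u. u \<in> nbrs G v \<Longrightarrow> u \<in> A \<or> nbrs G u \<inter> A \<noteq> {}"
    unfolding phase1_def by blast
  have "card {u \<in> nbrs G v. rest1 G u} \<le> 56 * card A"
  proof (rule card_UN_le_mult[OF A(1)])
    show "{u \<in> nbrs G v. rest1 G u} \<subseteq> (\<Union>a\<in>A. insert a (common G v a))"
      using A(4) unfolding common_def by blast
    show "finite (insert a (common G v a)) \<and> card (insert a (common G v a)) \<le> 56" if "a \<in> A" for a
    proof -
      have "a \<noteq> v" using that A(3) by blast
      then have "card (common G v a) < 56" using False unfolding phase2_def by (metis not_le)
      then show ?thesis using finite_common by (simp add: card_insert_if)
    qed
  qed
  then have le: "card {u \<in> nbrs G v. rest1 G u} \<le> 392" using A(2) by simp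
  have "{u \<in> cnbrs G v. rest2 G u} \<subseteq> insert v {u \<in> nbrs G v. rest1 G u}"
    unfolding cnbrs_def rest2_def rest1_def by blast
  then have "card {u \<in> cnbrs G v. rest2 G u} \<le> card (insert v {u \<in> nbrs G v. rest1 G u})"
    using finite_nbrs[OF wf] by (intro card_mono) auto
  also have "\<dots> \<le> Suc 392" using le finite_nbrs[OF wf] by (simp add: card_insert_if)
  finally show ?thesis by simp
qed

lemma load_le_1: "load G i v \<le> 1"
proof (induction i)
  case 0
  have "load G 0 v = (\<Sum>u\<in>{u \<in> cnbrs G v. rest2 G u}. 1/8 * (7/8) ^ 30)"
    unfolding load_def sum.inter_filter[OF finite_cnbrs] weight.simps(1) ..
  also have "\<dots> = real (card {u \<in> cnbrs G v. rest2 G u}) * (1/8 * (7/8) ^ 30)" by simp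
  also have "\<dots> \<le> 393 * (1/8 * (7/8) ^ 30)"
    using rest_degree[of v] by (intro mult_right_mono) auto
  also have "\<dots> \<le> 1" by (simp add: power_divide)
  finally show ?case .
next
  case (Suc i)
  then show ?case by (rule load_step)
qed

lemma dominating_selected: "dominating G {v \<in> verts G. selected G v}"
  unfolding dominating_def
proof (intro conjI ballI)
  fix v assume v: "v \<in> verts G"
  have "\<exists>w\<in>cnbrs G v. selected G w"
  proof (cases "rest2 G v")
    case True
    show ?thesis
    proof (cases "uncovered G v")
      case True
      then show ?thesis by (auto simp: cnbrs_def selected_def)
    next
      case False
      then obtain w where "w \<in> cnbrs G v" "7/8 \<le> load G 30 w"
        using \<open>rest2 G v\<close> unfolding uncovered_def by (meson not_le)
      then show ?thesis by (auto simp: selected_def)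
    qed
  qed (auto simp: rest2_def selected_def)
  then obtain w where w: "w \<in> cnbrs G v" "selected G w" by blast
  then show "v \<in> {v \<in> verts G. selected G v} \<or> (\<exists>u\<in>{v \<in> verts G. selected G v}. {u, v} \<in> edges G)"
    using v nbrs_subset[OF wf, of v] by (auto simp: cnbrs_def nbrs_def)
qed auto

context
  fixes D assumes pl: "planar G" and dom: "dominating G D"
begin

section \<open>Comparison with a dominating set \<open>D\<close>\<close>

lemma D_subset: "D \<subseteq> verts G"
  using dom by (simp add: dominating_def)

lemma finite_D: "finite D"
  by (rule finite_subset[OF D_subset finite_verts[OF wf]])

lemma dominator_ex:
  "\<exists>d. (\<forall>u\<in>D. d u = u) \<and> (\<forall>u\<in>verts G - D. d u \<in> D \<and> d u \<in> nbrs G u)"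
proof -
  have "\<exists>w. (u \<in> D \<longrightarrow> w = u) \<and> (u \<in> verts G - D \<longrightarrow> w \<in> D \<and> w \<in> nbrs G u)" for u
    using dom by (auto simp: dominating_def nbrs_def)
  then show ?thesis by metis
qed

text \<open>All partners of \<open>w\<close> lie in the set \<open>A\<close> that keeps
  \<open>w\<close> out of phase 1: any other \<open>v\<close> has at most 7 times 7 vertices in
  common with \<open>w\<close>, by \<open>planar_K37\<close> applied to \<open>v\<close>,
  \<open>w\<close> and each member of \<open>A\<close>.\<close>

lemma partners_le_7: "card {v. v \<noteq> w \<and> 56 \<le> card (common G v w)} \<le> 7 \<and> finite {v. v \<noteq> w \<and> 56 \<le> card (common G v w)}"
proof (cases "phase1 G w")
  case True
  then have "common G v w = {}" for v using not_phase1_if_common by blast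
  then show ?thesis by simp
next
  case False
  then obtain A where A: "finite A" "card A \<le> 7" "w \<notin> A" "\<And>u. u \<in> nbrs G w \<Longrightarrow> u \<in> A \<or> nbrs G u \<inter> A \<noteq> {}"
    unfolding phase1_def by blast
  have "{v. v \<noteq> w \<and> 56 \<le> card (common G v w)} \<subseteq> A"
  proof (rule subsetI, rule ccontr)
    fix v assume v: "v \<in> {v. v \<noteq> w \<and> 56 \<le> card (common G v w)}" "v \<notin> A"
    have "card (common G v w) \<le> 7 * card A"
    proof (rule card_UN_le_mult[OF A(1)])
      show "common G v w \<subseteq> (\<Union>a\<in>A. insert a (nbrs G v \<inter> nbrs G w \<inter> nbrs G a))"
      proof
        fix u assume u: "u \<in> common G v w"
        then have uw: "u \<in> nbrs G v" "u \<in> nbrs G w" using common_nbrs by blast+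
        then show "u \<in> (\<Union>a\<in>A. insert a (nbrs G v \<inter> nbrs G w \<inter> nbrs G a))"
          using A(4)[OF uw(2)] nbrs_sym by blast
      qed
      show "finite (insert a (nbrs G v \<inter> nbrs G w \<inter> nbrs G a)) \<and> card (insert a (nbrs G v \<inter> nbrs G w \<inter> nbrs G a)) \<le> 7"
        if "a \<in> A" for a
      proof -
        have "v \<noteq> w" "v \<noteq> a" "w \<noteq> a" using v A(3) that by auto
        then have "card (nbrs G v \<inter> nbrs G w \<inter> nbrs G a) \<le> 6" by (rule planar_K37[OF wf pl])
        then show ?thesis using finite_nbrs[OF wf] by (simp add: card_insert_if)
      qed
    qed
    then show False using v A(2) by simp
  qed
  from card_mono[OF A(1) this] finite_subset[OF this A(1)] show ?thesis using A(2) by linarith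
qed

text \<open>A vertex of \<open>P\<close> outside \<open>D\<close> either belongs to
  \<open>Q\<close>, which has at most \<open>3/2 * card D\<close> members, or is one of at most 7
  partners of some \<open>w\<close> in \<open>D \<inter> P\<close>.\<close>

lemma card_phases:
  defines "P \<equiv> {v \<in> verts G. phase1 G v \<or> phase2 G v}"
  shows "2 * card P \<le> 16 * card (D \<inter> P) + 3 * card D"
proof -
  obtain d where d: "\<And>u. u \<in> D \<Longrightarrow> d u = u" "\<And>u. u \<in> verts G - D \<Longrightarrow> d u \<in> D \<and> d u \<in> nbrs G u"
    using dominator_ex by blast
  define Q where "Q = {v \<in> verts G - D. 8 \<le> card (d ` nbrs G v)}"
  have dD: "d u \<in> D" "d u = u \<or> d u \<in> nbrs G u" if "u \<in> nbrs G v" for u v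
  proof -
    have "u \<in> verts G" using nbrs_subset[OF wf] that by blast
    then show "d u \<in> D" "d u = u \<or> d u \<in> nbrs G u"
      using d(1)[of u] d(2)[of u] by (cases "u \<in> D"; simp)+
  qed
  have fP: "finite P" "finite Q" using finite_verts[OF wf] by (auto simp: P_def Q_def)
  have "8 * card Q \<le> 6 * card Q + 3 * card D"
    by (rule many_dominators[OF wf pl D_subset _ d]) (auto simp: Q_def)
  then have cQ: "2 * card Q \<le> 3 * card D" by simp
  define F where "F w = {v. v \<noteq> w \<and> 56 \<le> card (common G v w)}" for w
  have F: "finite (F w) \<and> card (F w) \<le> 7" for w using partners_le_7[of w] by (simp add: F_def)
  have "v \<in> Q \<union> (\<Union>w\<in>D \<inter> P. F w)" if v: "v \<in> P" "v \<notin> D" for v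
  proof (cases "phase1 G v")
    case True
    \<comment> \<open>Otherwise the dominators of the neighbours would be an admissible
      \<open>A\<close> in \<open>phase1\<close>; \<open>v\<close> is not among them because it lies
      outside \<open>D\<close>.\<close>
    have "\<not> card (d ` nbrs G v) \<le> 7"
    proof
      assume c: "card (d ` nbrs G v) \<le> 7"
      have "v \<notin> d ` nbrs G v" using v(2) dD(1) by blast
      moreover have "u \<in> d ` nbrs G v \<or> nbrs G u \<inter> d ` nbrs G v \<noteq> {}" if "u \<in> nbrs G v" for u
        using dD(2)[OF that] that by (metis disjoint_iff image_eqI)
      ultimately show False
        using True c finite_nbrs[OF wf, of v] unfolding phase1_def by blast
    qed
    then show ?thesis using v by (simp add: Q_def P_def)
  next
    case False
    then obtain w where w: "w \<noteq> v" "56 \<le> card (common G v w)" using v by (auto simp: P_def phase2_def)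
    show ?thesis
    proof (cases "w \<in> D")
      case True
      have "phase2 G w" unfolding phase2_def using w common_sym by metis
      then have "w \<in> D \<inter> P" using True D_subset by (auto simp: P_def)
      then show ?thesis using w by (auto simp: F_def)
    next
      case wD: False
      let ?M = "common G v w"
      have "card ?M \<le> 7 * card (d ` ?M)"
      proof (rule card_UN_le_mult)
        show "finite (d ` ?M)" using finite_common by blast
        show "?M \<subseteq> (\<Union>y\<in>d ` ?M. insert y (nbrs G v \<inter> nbrs G w \<inter> nbrs G y))"
        proof
          fix u assume u: "u \<in> ?M"
          then have "u \<in> nbrs G v" "u \<in> nbrs G w" using common_nbrs by blast+
          then show "u \<in> (\<Union>y\<in>d ` ?M. insert y (nbrs G v \<inter> nbrs G w \<inter> nbrs G y))"
            using u dD(2)[of u v] nbrs_sym[of u G "d u"] by (intro UN_I[of "d u"]) auto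
        qed
        show "finite (insert y (nbrs G v \<inter> nbrs G w \<inter> nbrs G y)) \<and> card (insert y (nbrs G v \<inter> nbrs G w \<inter> nbrs G y)) \<le> 7"
          if "y \<in> d ` ?M" for y
        proof -
          have "y \<in> D" using that dD(1) common_nbrs by blast
          then have "v \<noteq> w" "v \<noteq> y" "w \<noteq> y" using v wD w by auto
          then have "card (nbrs G v \<inter> nbrs G w \<inter> nbrs G y) \<le> 6" by (rule planar_K37[OF wf pl])
          then show ?thesis using finite_nbrs[OF wf] by (simp add: card_insert_if)
        qed
      qed
      then have "8 \<le> card (d ` ?M)" using w(2) by simp
      also have "\<dots> \<le> card (d ` nbrs G v)"
        using finite_nbrs[OF wf, of v] common_nbrs[of G v w] by (intro card_mono) auto
      finally show ?thesis using v by (simp add: Q_def P_def)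
    qed
  qed
  then have sub: "P \<subseteq> (D \<inter> P) \<union> (Q \<union> (\<Union>w\<in>D \<inter> P. F w))" by blast
  have fU: "finite (\<Union>w\<in>D \<inter> P. F w)" using finite_D F by blast
  have "card P \<le> card ((D \<inter> P) \<union> (Q \<union> (\<Union>w\<in>D \<inter> P. F w)))"
    using sub fP finite_D fU by (intro card_mono) auto
  also have "\<dots> \<le> card (D \<inter> P) + (card Q + card (\<Union>w\<in>D \<inter> P. F w))"
    by (meson card_Un_le add_left_mono le_trans)
  also have "card (\<Union>w\<in>D \<inter> P. F w) \<le> 7 * card (D \<inter> P)"
    by (rule card_UN_le_mult[OF _ order_refl]) (use F finite_D in auto)
  finally show ?thesis using cQ by simp
qed

text \<open>The weights form a feasible dual solution of total at most \<open>card (D - P)\<close>.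
  Vertices of \<open>U\<close> have weight 1/8 each, and \<open>card S\<close> is at most 8 times
  the remaining weight, because sparsity limits how often the heavy vertices can share a
  weight.\<close>

lemma card_primal_dual:
  defines "P \<equiv> {v \<in> verts G. phase1 G v \<or> phase2 G v}"
    and "S \<equiv> {v \<in> verts G. 7/8 \<le> load G 30 v}"
    and "U \<equiv> {v \<in> verts G. uncovered G v}"
  shows "card S + card U \<le> 8 * card (D - P)"
proof -
  let ?V = "verts G"
  let ?x = "weight G 30"
  define R where "R = {u \<in> ?V. rest2 G u}"
  have fin: "finite ?V" "finite R" "finite S" "finite U"
    using finite_verts[OF wf] by (auto simp: R_def S_def U_def)
  have UR: "U \<subseteq> R" by (auto simp: U_def R_def uncovered_def)
  have xU: "?x u = 1/8" if "u \<in> U" for u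
  proof -
    have "?x u = 1/8 * (7/8) ^ 30 * (8/7) ^ 30"
      using that by (intro weight_active) (auto simp: U_def uncovered_def)
    then show ?thesis by (simp add: power_divide)
  qed
  have cU: "real (card U) = 8 * (\<Sum>u\<in>U. ?x u)"
    by (subst sum.cong[OF HOL.refl xU]) simp_all
  \<comment> \<open>Dropping the weights on \<open>U\<close> leaves the neighbour sums at
    \<open>S\<close> unchanged, since an uncovered vertex has no neighbour in
    \<open>S\<close>.\<close>
  define y where "y u = (if u \<in> R - U then ?x u else 0)" for u
  have y: "0 \<le> y u" "y u \<le> 1/8" for u using weight_nonneg weight_le_eighth by (auto simp: y_def)
  define f where "f v = (if v \<in> S then 1/8 else 0) + y v" for v
  have f0: "0 \<le> f v" for v using y by (simp add: f_def)
  have yx: "?x u = y u" if "v \<in> S" "u \<in> nbrs G v" for u v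
  proof -
    have "u \<in> ?V" using nbrs_subset[OF wf] that by blast
    moreover have "v \<in> cnbrs G u" using that nbrs_sym[of u G v] by (simp add: cnbrs_def)
    then have "u \<notin> U" using that(1) unfolding U_def uncovered_def S_def by force
    ultimately show ?thesis using weight_zero[of G u 30] by (auto simp: y_def R_def)
  qed
  define A where "A = Sigma ?V (nbrs G)"
  have A: "A \<subseteq> ?V \<times> ?V" using nbrs_subset[OF wf] by (auto simp: A_def)
  have fA: "finite A" using A fin finite_subset[OF A] by simp
  have swapA: "(u, v) \<in> A" if "(v, u) \<in> A" for u v
    using that nbrs_sym[of u G v] nbrs_subset[OF wf, of v] by (auto simp: A_def)
  have Asw: "(\<Sum>(v, u)\<in>A. h u v) = (\<Sum>(v, u)\<in>A. h v u)" for h :: "nat \<Rightarrow> nat \<Rightarrow> real"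
  proof (rule sum.reindex_bij_witness[of _ prod.swap prod.swap])
    show "prod.swap z \<in> A" if "z \<in> A" for z
      using that swapA by (cases z) simp
    show "prod.swap z \<in> A" if "z \<in> A" for z
      using that swapA by (cases z) simp
  qed auto
  \<comment> \<open>The level 1/8 that \<open>f\<close> adds on \<open>S\<close> is an upper bound
    for \<open>y\<close>, so one minimum pays for both directions of an edge, even when both ends
    are in \<open>S\<close>.\<close>
  have pt: "(if v \<in> S then y u else 0) + (if u \<in> S then y v else 0) \<le> min (f v) (f u)" for u v
    using y(1)[of u] y(2)[of u] y(1)[of v] y(2)[of v] by (auto simp: f_def)
  have VS: "?V \<inter> S = S" by (auto simp: S_def)
  \<comment> \<open>\<open>A\<close> contains both orientations of each edge, which doubles the
    density 3. The symmetry \<open>Asw\<close> halves the result again.\<close>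
  have "(\<Sum>(v, u)\<in>A. min (f v) (f u)) \<le> 6 * (\<Sum>v\<in>?V. f v)"
  proof (rule sum_min_le_of_density[OF fin(1) A _ f0])
    fix T assume T: "T \<subseteq> ?V"
    have "A \<inter> T \<times> T = (SIGMA v:T. nbrs G v \<inter> T)" using T by (auto simp: A_def)
    then have "card (A \<inter> T \<times> T) = (\<Sum>v\<in>T. card (nbrs G v \<inter> T))"
      using finite_subset[OF T fin(1)] finite_nbrs[OF wf] by simp
    also have "\<dots> \<le> 6 * card T"
      using handshake[OF wf T] planar_density[OF wf pl T] by simp
    finally show "real (card (A \<inter> T \<times> T)) \<le> 6 * real (card T)" by linarith
  qed
  moreover have "(\<Sum>(v, u)\<in>A. (if v \<in> S then y u else 0) + (if u \<in> S then y v else 0)) \<le> (\<Sum>(v, u)\<in>A. min (f v) (f u))"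
    using pt by (intro sum_mono) auto
  moreover have "(\<Sum>(v, u)\<in>A. (if v \<in> S then y u else 0) + (if u \<in> S then y v else 0)) =
    2 * (\<Sum>(v, u)\<in>A. if v \<in> S then y u else 0)"
    using Asw[of "\<lambda>v u. if v \<in> S then y u else 0"] by (simp add: sum.distrib case_prod_unfold)
  ultimately have half: "(\<Sum>(v, u)\<in>A. if v \<in> S then y u else 0) \<le> 3 * (\<Sum>v\<in>?V. f v)" by linarith
  have "(\<Sum>(v, u)\<in>A. if v \<in> S then y u else 0) = (\<Sum>v\<in>?V. \<Sum>u\<in>nbrs G v. if v \<in> S then y u else 0)"
    unfolding A_def using fin finite_nbrs[OF wf] by (simp add: sum.Sigma)
  also have "\<dots> = (\<Sum>v\<in>?V. if v \<in> S then \<Sum>u\<in>nbrs G v. y u else 0)"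
    by (rule sum.cong) auto
  also have "\<dots> = (\<Sum>v\<in>S. \<Sum>u\<in>nbrs G v. y u)"
    using sum.inter_restrict[OF fin(1), of "\<lambda>v. \<Sum>u\<in>nbrs G v. y u" S] VS by simp
  also have "\<dots> = (\<Sum>v\<in>S. \<Sum>u\<in>nbrs G v. ?x u)"
    using yx by (intro sum.cong) auto
  finally have half': "(\<Sum>v\<in>S. \<Sum>u\<in>nbrs G v. ?x u) \<le> 3 * (\<Sum>v\<in>?V. f v)" using half by simp
  have sf: "(\<Sum>v\<in>?V. f v) = 1/8 * real (card S) + (\<Sum>u\<in>R - U. ?x u)"
  proof -
    have "?V \<inter> (R - U) = R - U" by (auto simp: R_def)
    with VS have "(\<Sum>v\<in>?V. if v \<in> S then 1/8 else 0) = 1/8 * real (card S)" "(\<Sum>v\<in>?V. y v) = (\<Sum>u\<in>R - U. ?x u)"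
      unfolding y_def using fin(1) by (simp_all only: sum.inter_restrict[symmetric]) simp
    then show ?thesis by (simp add: f_def sum.distrib)
  qed
  have "7/8 * real (card S) = (\<Sum>v\<in>S. 7/8)" by simp
  also have "\<dots> \<le> (\<Sum>v\<in>S. load G 30 v)" by (intro sum_mono) (auto simp: S_def)
  also have "\<dots> = (\<Sum>v\<in>S. ?x v + (\<Sum>u\<in>nbrs G v. ?x u))"
    unfolding load_def cnbrs_def using finite_nbrs[OF wf] nbrs_irrefl[OF wf] by simp
  also have "\<dots> \<le> (\<Sum>v\<in>S. 1/8 + (\<Sum>u\<in>nbrs G v. ?x u))"
    using weight_le_eighth by (intro sum_mono) simp
  also have "\<dots> = 1/8 * real (card S) + (\<Sum>v\<in>S. \<Sum>u\<in>nbrs G v. ?x u)" by (simp add: sum.distrib)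
  \<comment> \<open>Of the coefficient 7/8 of \<open>card S\<close>, 1/8 goes to the own weights and
    3/8 to the part of \<open>f\<close> on \<open>S\<close>. The remaining 3/8 is at most 3 times
    the weight on \<open>R - U\<close>.\<close>
  finally have cS: "real (card S) \<le> 8 * (\<Sum>u\<in>R - U. ?x u)" using half' sf by argo
  \<comment> \<open>Weak duality: a vertex of \<open>R\<close> has no phase vertex in its closed
    neighbourhood, so its dominator is in \<open>D - P\<close>, where loads are at most 1.\<close>
  have "(\<Sum>u\<in>R. ?x u) \<le> (\<Sum>u\<in>R. \<Sum>v\<in>D - P. if u \<in> cnbrs G v then ?x u else 0)"
  proof (rule sum_mono)
    fix u assume u: "u \<in> R"
    then obtain v where v: "v \<in> D" "v \<in> cnbrs G u"
      using dom by (auto simp: dominating_def R_def cnbrs_def nbrs_def)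
    then have "v \<in> D - P" "u \<in> cnbrs G v" using u cnbrs_sym by (auto simp: P_def R_def rest2_def)
    then show "?x u \<le> (\<Sum>v\<in>D - P. if u \<in> cnbrs G v then ?x u else 0)"
      using member_le_sum[of v "D - P" "\<lambda>v. if u \<in> cnbrs G v then ?x u else 0"] finite_D weight_nonneg by simp
  qed
  also have "\<dots> = (\<Sum>v\<in>D - P. \<Sum>u\<in>R. if u \<in> cnbrs G v then ?x u else 0)" by (rule sum.swap)
  also have "\<dots> \<le> (\<Sum>v\<in>D - P. load G 30 v)"
  proof (rule sum_mono)
    fix v
    have "(\<Sum>u\<in>R. if u \<in> cnbrs G v then ?x u else 0) = (\<Sum>u\<in>R \<inter> cnbrs G v. ?x u)"
      using fin(2) by (simp add: sum.inter_restrict)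
    also have "\<dots> \<le> load G 30 v"
      unfolding load_def using weight_nonneg finite_cnbrs by (intro sum_mono2) auto
    finally show "(\<Sum>u\<in>R. if u \<in> cnbrs G v then ?x u else 0) \<le> load G 30 v" .
  qed
  also have "\<dots> \<le> (\<Sum>v\<in>D - P. 1)" by (intro sum_mono load_le_1)
  finally have "(\<Sum>u\<in>R. ?x u) \<le> real (card (D - P))" by simp
  moreover have "(\<Sum>u\<in>R. ?x u) = (\<Sum>u\<in>R - U. ?x u) + (\<Sum>u\<in>U. ?x u)"
    using sum.subset_diff[OF UR fin(2)] .
  ultimately have "real (card S) + real (card U) \<le> 8 * real (card (D - P))" using cS cU by argo
  then show ?thesis by linarith
qed

text \<open>Each vertex of \<open>D\<close> pays for 8 selected vertices, either in the two phases
  or in the primal-dual part; the set \<open>Q\<close> adds another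
  \<open>3/2 * card D\<close>.\<close>

lemma card_selected: "2 * card {v \<in> verts G. selected G v} \<le> 19 * card D"
proof -
  let ?P = "{v \<in> verts G. phase1 G v \<or> phase2 G v}"
  let ?S = "{v \<in> verts G. 7/8 \<le> load G 30 v}" and ?U = "{v \<in> verts G. uncovered G v}"
  have "{v \<in> verts G. selected G v} = ?P \<union> (?S \<union> ?U)" by (auto simp: selected_def)
  then have "card {v \<in> verts G. selected G v} \<le> card ?P + (card ?S + card ?U)"
    by (metis (no_types, lifting) card_Un_le add_left_mono le_trans)
  moreover have "card D = card (D \<inter> ?P) + card (D - ?P)"
    using finite_D by (metis card_Int_Diff)
  ultimately show ?thesis using card_phases card_primal_dual by simp
qed

end
end

lemma domination_number_attained:
  assumes "wf_graph G"
  obtains D where "dominating G D" "card D = domination_number G"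
proof -
  have "finite {D. dominating G D}"
    by (rule finite_subset[of _ "Pow (verts G)"]) (auto simp: dominating_def finite_verts[OF assms])
  moreover have "dominating G (verts G)" by (simp add: dominating_def)
  ultimately have "domination_number G \<in> card ` {D. dominating G D}"
    unfolding domination_number_def by (intro Min_in) auto
  then show thesis using that by auto
qed

theorem theorem3:
  shows "\<exists>(A :: real \<Rightarrow> graph \<Rightarrow> nat \<Rightarrow> bool) (C :: real \<Rightarrow> nat).
    local_algorithm A C \<and>
    (\<forall>G eps. wf_graph G \<longrightarrow> planar G \<longrightarrow> eps > 0 \<longrightarrow>
       dominating G {v \<in> verts G. A eps G v} \<and>
       real (card {v \<in> verts G. A eps G v}) \<le> (11 + eps) * real (domination_number G))"
proof (intro exI conjI allI impI)
  show "local_algorithm (\<lambda>_. selected) (\<lambda>_. 67)"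
    unfolding local_algorithm_def using selected_local agree_if_local_view_eq by blast
  fix G and eps :: real
  assume G: "wf_graph G" "planar G" "eps > 0"
  show "dominating G {v \<in> verts G. selected G v}" using dominating_selected[OF G(1)] .
  obtain D where D: "dominating G D" "card D = domination_number G"
    by (rule domination_number_attained[OF G(1)])
  have "2 * card {v \<in> verts G. selected G v} \<le> 19 * domination_number G"
    using card_selected[OF G(1,2) D(1)] D(2) by simp
  then have "real (card {v \<in> verts G. selected G v}) \<le> 11 * real (domination_number G)" by linarith
  also have "\<dots> \<le> (11 + eps) * real (domination_number G)" using G(3) by (intro mult_right_mono) auto
  finally show "real (card {v \<in> verts G. selected G v}) \<le> (11 + eps) * real (domination_number G)" .
qed

end
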